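(* Let $(F_0,\nu_0)$ be an isoparametric hypersurface in $\mathbb{S}^{n+1}$ with $g$ distinct principal curvatures, $F_0:M\hookrightarrow\mathbb{S}^{n+1}$, $M$ compact. For every $j\in\{1,\dots,g\}$, $p\in M$ and $X,Y,Z\in T_pM$, $$\alpha_{|p}(X,Y,Z)=-\alpha_{|\tau_j(p)}(d\tau_{j|p}X,d\tau_{j|p}Y,d\tau_{j|p}Z),$$ i.e. $(\tau_j)_*\alpha=-\alpha$. Furthermore the higher covariant derivatives of $\alpha$ transform in the same way: $\nabla^i\alpha=-(\tau_j)_*\nabla^i\alpha$ for all $i\geq0$.
   Context: $M$ is a connected smooth $n$-manifold, $F_0:M\hookrightarrow\mathbb{S}^{n+1}\subset\mathbb{R}^{n+2}$ an embedding with unit normal field $\nu_0$ (tangent to the sphere) whose principal curvatures are constant (an isoparametric hypersurface). Shape operator: $d\nu_0=-dF_0A_0$; the $g$ distinct principal curvatures are $\lambda_1>\dots>\lambda_g$, $\lambda_j=\cot\theta_j$, with the standing normalization (choice of the hypersurface within its family of parallel hypersurfaces) $\theta_j=(2j-1)\frac{\pi}{2g}$ modulo $\pi$. $g_0$ is the metric induced by $F_0$, $\nabla^0$ its Levi-Civita connection. $F_t=\cos(t)F_0+\sin(t)\nu_0$, $\nu_t=-\sin(t)F_0+\cos(t)\nu_0$. Since $F_t\mapsto F_{2\theta_k-t}$ maps the hypersurface $F_t(M)$ onto itself and flips the sign of the normal field, there are diffeomorphisms $\tau_k:M\to M$ with $F_t\circ\tau_k=F_{2\theta_k-t}$ and $\nu_t\circ\tau_k=-\nu_{2\theta_k-t}$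 for all $t$; they are involutions (reflections in the focal submanifolds). $\alpha(X,Y,Z)=g_0((\nabla^0_XA_0)Y,Z)$. $\hat g(X,Y)=g_0(X,\frac12(\mathrm{Id}+A_0^2)Y)$ is a Riemannian metric on $M$, and $\nabla$ denotes its Levi-Civita connection. $(\tau_j)_*$ denotes push-forward of covariant tensors by the involution $\tau_j$ (equal to pull-back by $\tau_j$). *)

theory Defs
  imports "HOL-Analysis.Analysis" "HOL-Library.Function_Algebras"
begin

text \<open>Only meant for open \<open>S\<close>.\<close>

primrec k_smooth_on :: "nat \<Rightarrow> 'a::real_normed_vector set \<Rightarrow> ('a \<Rightarrow> 'b::real_normed_vector) \<Rightarrow> bool"
  where
    "k_smooth_on 0 S f \<longleftrightarrow> continuous_on S f"
  | "k_smooth_on (Suc k) S f \<longleftrightarrow>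
       (\<forall>x\<in>S. f differentiable (at x)) \<and>
       (\<forall>v. k_smooth_on k S (\<lambda>x. frechet_derivative f (at x) v))"

definition smooth_on :: "'a::real_normed_vector set \<Rightarrow> ('a \<Rightarrow> 'b::real_normed_vector) \<Rightarrow> bool"
  where "smooth_on S f \<longleftrightarrow> (\<forall>k. k_smooth_on k S f)"

text \<open>
  The manifold is the whole type \<open>'m\<close>, with its type class topology; the smooth structure is
  given by an atlas (not necessarily maximal) of charts \<open>\<phi> : U \<rightarrow> \<real>\<^sup>n\<close>, where \<open>n = CARD('n)\<close>.
\<close>

type_synonym ('m, 'n) atlas = "('m set \<times> ('m \<Rightarrow> real ^ 'n)) set"

definition smooth_atlas ::
    "('m::{t2_space, second_countable_topology}, 'n::finite) atlas \<Rightarrow> bool"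
  where "smooth_atlas A \<longleftrightarrow>
    (\<Union>(U, \<phi>)\<in>A. U) = UNIV \<and>
    (\<forall>(U, \<phi>)\<in>A. open U \<and> open (\<phi> ` U) \<and> homeomorphism U (\<phi> ` U) \<phi> (inv_into U \<phi>)) \<and>
    (\<forall>(U, \<phi>)\<in>A. \<forall>(V, \<psi>)\<in>A. smooth_on (\<phi> ` (U \<inter> V)) (\<psi> \<circ> inv_into U \<phi>))"

definition smooth_fun_on ::
    "('m::topological_space, 'n::finite) atlas \<Rightarrow> 'm set \<Rightarrow> ('m \<Rightarrow> 'b::real_normed_vector) \<Rightarrow> bool"
  where "smooth_fun_on A W f \<longleftrightarrow> (\<forall>(U, \<phi>)\<in>A. smooth_on (\<phi> ` (U \<inter> W)) (f \<circ> inv_into U \<phi>))"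

definition smooth_at ::
    "('m::topological_space, 'n::finite) atlas \<Rightarrow> 'm \<Rightarrow> ('m \<Rightarrow> 'b::real_normed_vector) \<Rightarrow> bool"
  where "smooth_at A p f \<longleftrightarrow> (\<exists>W. open W \<and> p \<in> W \<and> smooth_fun_on A W f)"

definition smooth_self_map :: "('m::topological_space, 'n::finite) atlas \<Rightarrow> ('m \<Rightarrow> 'm) \<Rightarrow> bool"
  where "smooth_self_map A \<tau> \<longleftrightarrow> continuous_on UNIV \<tau> \<and>
    (\<forall>(U, \<phi>)\<in>A. \<forall>(V, \<psi>)\<in>A. smooth_on (\<phi> ` (U \<inter> \<tau> -` V)) (\<psi> \<circ> \<tau> \<circ> inv_into U \<phi>))"

definition diffeomorphism :: "('m::topological_space, 'n::finite) atlas \<Rightarrow> ('m \<Rightarrow> 'm) \<Rightarrow> bool"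
  where "diffeomorphism A \<tau> \<longleftrightarrow>
    bij \<tau> \<and> smooth_self_map A \<tau> \<and> smooth_self_map A (inv \<tau>)"

text \<open>
  A tangent vector at \<open>p\<close> is the functional \<open>f \<mapsto> (f \<circ> \<gamma>)'(0)\<close> determined by a smooth curve \<open>\<gamma>\<close>
  through \<open>p\<close>. Its arguments are the functions that are smooth near \<open>p\<close>; to make these
  functionals total, they take the value \<open>0\<close> on all other functions. Addition and the zero vector
  are the pointwise ones.
\<close>

type_synonym 'm tvec = "('m \<Rightarrow> real) \<Rightarrow> real"
type_synonym 'm vfield = "'m \<Rightarrow> 'm tvec"

definition smooth_curve_through ::
    "('m::topological_space, 'n::finite) atlas \<Rightarrow> 'm \<Rightarrow> (real \<Rightarrow> 'm) \<Rightarrow> bool"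
  where "smooth_curve_through A p \<gamma> \<longleftrightarrow> \<gamma> 0 = p \<and>
    (\<exists>e>0. continuous_on {-e<..<e} \<gamma> \<and>
       (\<forall>(U, \<phi>)\<in>A. smooth_on ({-e<..<e} \<inter> \<gamma> -` U) (\<phi> \<circ> \<gamma>)))"

definition tangent_space ::
    "('m::topological_space, 'n::finite) atlas \<Rightarrow> 'm \<Rightarrow> 'm tvec set"
  where "tangent_space A p =
    {\<lambda>f. if smooth_at A p f then deriv (f \<circ> \<gamma>) 0 else 0 | \<gamma>. smooth_curve_through A p \<gamma>}"

definition tscale :: "real \<Rightarrow> 'm tvec \<Rightarrow> 'm tvec"
  where "tscale c x = (\<lambda>f. c * x f)"

definition differential ::
    "('m::topological_space, 'n::finite) atlas \<Rightarrow> ('m \<Rightarrow> 'm) \<Rightarrow> 'm \<Rightarrow> 'm tvec \<Rightarrow> 'm tvec"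
  where "differential A \<tau> p x = (\<lambda>f. if smooth_at A (\<tau> p) f then x (f \<circ> \<tau>) else 0)"

text \<open>The differential of a map into Euclidean space, with \<open>T\<^sub>y\<real>\<^sup>k = \<real>\<^sup>k\<close>.\<close>

definition vdiff :: "('m \<Rightarrow> real ^ 'k) \<Rightarrow> 'm tvec \<Rightarrow> real ^ 'k"
  where "vdiff F x = (\<chi> a. x (\<lambda>q. F q $ a))"

definition vector_fields :: "('m::topological_space, 'n::finite) atlas \<Rightarrow> 'm vfield set"
  where "vector_fields A = {X.
    (\<forall>p. X p \<in> tangent_space A p) \<and>
    (\<forall>W f. open W \<longrightarrow> smooth_fun_on A W f \<longrightarrow> smooth_fun_on A W (\<lambda>q. X q f))}"

definition lie_bracket ::
    "('m::topological_space, 'n::finite) atlas \<Rightarrow> 'm vfield \<Rightarrow> 'm vfield \<Rightarrow> 'm vfield"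
  where "lie_bracket A X Y = (\<lambda>p f.
    if smooth_at A p f then X p (\<lambda>q. Y q f) - Y p (\<lambda>q. X q f) else 0)"

definition connection ::
    "('m::topological_space, 'n::finite) atlas \<Rightarrow> ('m vfield \<Rightarrow> 'm vfield \<Rightarrow> 'm vfield) \<Rightarrow> bool"
  where "connection A D \<longleftrightarrow>
    (\<forall>X\<in>vector_fields A. \<forall>Y\<in>vector_fields A. D X Y \<in> vector_fields A) \<and>
    (\<forall>X\<in>vector_fields A. \<forall>X'\<in>vector_fields A. \<forall>Y\<in>vector_fields A.
       D (X + X') Y = D X Y + D X' Y \<and> D Y (X + X') = D Y X + D Y X') \<and>
    (\<forall>X\<in>vector_fields A. \<forall>Y\<in>vector_fields A. \<forall>f. smooth_fun_on A UNIV f \<longrightarrow>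
       D (\<lambda>q. tscale (f q) (X q)) Y = (\<lambda>q. tscale (f q) (D X Y q)) \<and>
       D X (\<lambda>q. tscale (f q) (Y q)) = (\<lambda>q. tscale (X q f) (Y q) + tscale (f q) (D X Y q)))"

definition levi_civita ::
    "('m::topological_space, 'n::finite) atlas \<Rightarrow> ('m \<Rightarrow> 'm tvec \<Rightarrow> 'm tvec \<Rightarrow> real) \<Rightarrow>
     ('m vfield \<Rightarrow> 'm vfield \<Rightarrow> 'm vfield) \<Rightarrow> bool"
  where "levi_civita A h D \<longleftrightarrow> connection A D \<and>
    (\<forall>X\<in>vector_fields A. \<forall>Y\<in>vector_fields A. D X Y - D Y X = lie_bracket A X Y) \<and>
    (\<forall>X\<in>vector_fields A. \<forall>Y\<in>vector_fields A. \<forall>Z\<in>vector_fields A. \<forall>p.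
       X p (\<lambda>q. h q (Y q) (Z q)) = h p (D X Y p) (Z p) + h p (Y p) (D X Z p))"

text \<open>
  \<open>(\<nabla>\<^sub>x S) y\<close> for a field \<open>S\<close> of endomorphisms of the tangent spaces and \<open>x, y \<in> T\<^sub>pM\<close>, computed
  with arbitrary vector fields extending \<open>x\<close> and \<open>y\<close> (the value does not depend on them).
\<close>

definition cov_deriv_endo ::
    "('m::topological_space, 'n::finite) atlas \<Rightarrow> ('m vfield \<Rightarrow> 'm vfield \<Rightarrow> 'm vfield) \<Rightarrow>
     ('m \<Rightarrow> 'm tvec \<Rightarrow> 'm tvec) \<Rightarrow> 'm \<Rightarrow> 'm tvec \<Rightarrow> 'm tvec \<Rightarrow> 'm tvec"
  where "cov_deriv_endo A D S p x y = (THE w.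
    \<forall>X\<in>vector_fields A. \<forall>Y\<in>vector_fields A. X p = x \<longrightarrow> Y p = y \<longrightarrow>
      w = D X (\<lambda>q. S q (Y q)) p - S p (D X Y p))"

text \<open>A covariant \<open>k\<close>-tensor at \<open>p\<close> takes a list of \<open>k\<close> tangent vectors at \<open>p\<close>.\<close>

type_synonym 'm tensor = "'m \<Rightarrow> 'm tvec list \<Rightarrow> real"

text \<open>
  \<open>(\<nabla>T)(x, y\<^sub>1, \<dots>, y\<^sub>k) = (\<nabla>\<^sub>x T)(y\<^sub>1, \<dots>, y\<^sub>k)
     = x(T(Y\<^sub>1, \<dots>, Y\<^sub>k)) - \<Sum>\<^sub>i T(y\<^sub>1, \<dots>, \<nabla>\<^sub>x Y\<^sub>i, \<dots>, y\<^sub>k)\<close>,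
  again computed with arbitrary vector fields \<open>X, Y\<^sub>1, \<dots>, Y\<^sub>k\<close> extending the arguments.
\<close>

definition cov_deriv ::
    "('m::topological_space, 'n::finite) atlas \<Rightarrow> ('m vfield \<Rightarrow> 'm vfield \<Rightarrow> 'm vfield) \<Rightarrow>
     'm tensor \<Rightarrow> 'm tensor"
  where "cov_deriv A D T p vs = (THE r.
    \<forall>X Ys. X \<in> vector_fields A \<longrightarrow> set Ys \<subseteq> vector_fields A \<longrightarrow> map (\<lambda>Y. Y p) (X # Ys) = vs \<longrightarrow>
      r = X p (\<lambda>q. T q (map (\<lambda>Y. Y q) Ys))
          - (\<Sum>i<length Ys. T p ((map (\<lambda>Y. Y p) Ys)[i := D X (Ys ! i) p])))"

definition push_forward ::
    "('m::topological_space, 'n::finite) atlas \<Rightarrow> ('m \<Rightarrow> 'm) \<Rightarrow> 'm tensor \<Rightarrow> 'm tensor"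
  where "push_forward A \<tau> T p vs = T (inv \<tau> p) (map (differential A (inv \<tau>) p) vs)"

definition sphere_embedding ::
    "('m::topological_space, 'n::finite) atlas \<Rightarrow> ('m \<Rightarrow> real ^ 'k) \<Rightarrow> bool"
  where "sphere_embedding A F \<longleftrightarrow>
    smooth_fun_on A UNIV F \<and> (\<forall>p. norm (F p) = 1) \<and>
    (\<forall>p. inj_on (vdiff F) (tangent_space A p)) \<and>
    (\<exists>G. homeomorphism UNIV (range F) F G)"

definition unit_normal_field ::
    "('m::topological_space, 'n::finite) atlas \<Rightarrow> ('m \<Rightarrow> real ^ 'k) \<Rightarrow> ('m \<Rightarrow> real ^ 'k) \<Rightarrow> bool"
  where "unit_normal_field A F \<nu> \<longleftrightarrow>
    smooth_fun_on A UNIV \<nu> \<and> (\<forall>p. norm (\<nu> p) = 1) \<and> (\<forall>p. \<nu> p \<bullet> F p = 0) \<and>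
    (\<forall>p. \<forall>x\<in>tangent_space A p. \<nu> p \<bullet> vdiff F x = 0)"

definition shape_operator ::
    "('m::topological_space, 'n::finite) atlas \<Rightarrow> ('m \<Rightarrow> real ^ 'k) \<Rightarrow> ('m \<Rightarrow> real ^ 'k) \<Rightarrow>
     'm \<Rightarrow> 'm tvec \<Rightarrow> 'm tvec"
  where "shape_operator A F \<nu> p x =
    (THE w. w \<in> tangent_space A p \<and> vdiff \<nu> x = - vdiff F w)"

definition principal_curvatures ::
    "('m::topological_space, 'n::finite) atlas \<Rightarrow> ('m \<Rightarrow> real ^ 'k) \<Rightarrow> ('m \<Rightarrow> real ^ 'k) \<Rightarrow>
     'm \<Rightarrow> real set"
  where "principal_curvatures A F \<nu> p =
    {c. \<exists>x\<in>tangent_space A p. x \<noteq> 0 \<and> shape_operator A F \<nu> p x = tscale c x}"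

text \<open>
  The codimension in the sphere is one: for an \<open>n\<close>-manifold, the ambient space is \<open>\<real>\<^sup>n\<^sup>+\<^sup>2\<close>.
\<close>

definition isoparametric ::
    "('m::topological_space, 'n::finite) atlas \<Rightarrow> ('m \<Rightarrow> real ^ 'k) \<Rightarrow> ('m \<Rightarrow> real ^ 'k) \<Rightarrow> bool"
  where "isoparametric A F \<nu> \<longleftrightarrow>
    CARD('k) = CARD('n) + 2 \<and> sphere_embedding A F \<and> unit_normal_field A F \<nu> \<and>
    (\<forall>p q. principal_curvatures A F \<nu> p = principal_curvatures A F \<nu> q)"

definition parallel :: "('m \<Rightarrow> real ^ 'k) \<Rightarrow> ('m \<Rightarrow> real ^ 'k) \<Rightarrow> real \<Rightarrow> 'm \<Rightarrow> real ^ 'k"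
  where "parallel F \<nu> t p = cos t *\<^sub>R F p + sin t *\<^sub>R \<nu> p"

definition parallel_normal :: "('m \<Rightarrow> real ^ 'k) \<Rightarrow> ('m \<Rightarrow> real ^ 'k) \<Rightarrow> real \<Rightarrow> 'm \<Rightarrow> real ^ 'k"
  where "parallel_normal F \<nu> t p = - sin t *\<^sub>R F p + cos t *\<^sub>R \<nu> p"

definition induced_metric :: "('m \<Rightarrow> real ^ 'k) \<Rightarrow> 'm \<Rightarrow> 'm tvec \<Rightarrow> 'm tvec \<Rightarrow> real"
  where "induced_metric F p x y = vdiff F x \<bullet> vdiff F y"

definition ghat ::
    "('m::topological_space, 'n::finite) atlas \<Rightarrow> ('m \<Rightarrow> real ^ 'k) \<Rightarrow> ('m \<Rightarrow> real ^ 'k) \<Rightarrow>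
     'm \<Rightarrow> 'm tvec \<Rightarrow> 'm tvec \<Rightarrow> real"
  where "ghat A F \<nu> p x y = induced_metric F p x
    (tscale (1/2) (y + shape_operator A F \<nu> p (shape_operator A F \<nu> p y)))"

text \<open>Only meant for lists \<open>vs\<close> of length three; \<open>D0\<close> is the Levi-Civita connection of \<open>g\<^sub>0\<close>.\<close>

definition alpha ::
    "('m::topological_space, 'n::finite) atlas \<Rightarrow> ('m \<Rightarrow> real ^ 'k) \<Rightarrow> ('m \<Rightarrow> real ^ 'k) \<Rightarrow>
     ('m vfield \<Rightarrow> 'm vfield \<Rightarrow> 'm vfield) \<Rightarrow> 'm tensor"
  where "alpha A F \<nu> D0 p vs =
    induced_metric F p
      (cov_deriv_endo A D0 (shape_operator A F \<nu>) p (vs ! 0) (vs ! 1)) (vs ! 2)"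

end

theory Submission
  imports Defs
begin

text \<open>
  Evaluating the parallel family at \<open>t = 0\<close> gives \<open>F \<circ> \<tau> = c F + s \<nu>\<close> and
  \<open>\<nu> \<circ> \<tau> = s F - c \<nu>\<close> with \<open>c = cos 2\<theta>\<close>, \<open>s = sin 2\<theta>\<close>: the involution \<open>\<tau>\<close> acts on
  the pair \<open>(F, \<nu>)\<close> by a reflection of the plane. Splitting the derivatives of \<open>dF Y\<close> and \<open>d\<nu> Y\<close>
  into tangential and normal parts turns \<open>\<alpha>\<close> into
  \<open>\<alpha>(X, Y, Z) = \<langle>X(dF Y), d\<nu> Z\<rangle> - \<langle>X(d\<nu> Y), dF Z\<rangle>\<close>,
  which is multiplied by the determinant \<open>-1\<close> of that reflection, whereas
  \<open>2 ghat(X, Y) = \<langle>dF X, dF Y\<rangle> + \<langle>d\<nu> X, d\<nu> Y\<rangle>\<close> is invariant. So \<open>\<tau>\<close> is an isometry of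
  \<open>ghat\<close>, it preserves \<open>\<nabla>\<close>, and the sign passes to all derivatives \<open>\<nabla>\<^sup>i \<alpha>\<close>.
  The operators in the definitions are computed with arbitrary extensions to vector fields;
  extensions exist and do not matter because the tangential projections of the constant
  vector fields of the ambient space form a global frame.
\<close>

section \<open>Calculus of smooth functions\<close>

text \<open>The obstacle is well-definedness rather than the sign. Connections act on globally
  defined vector fields and are known only through their laws, while the pointwise derivatives are
  \<open>THE\<close> values over all extensions of the arguments; each must be shown independent of
  the extension before it can be reflected. The embedding supplies what cutoff functions would
  otherwise do: a field X is the sum of \<open>X(F_a)\<close> times \<open>frame a\<close>, with
  coefficients that are smooth on the whole manifold, so anything additive and linear over functions
  sees only the value \<open>X p\<close>. The derivative terms \<open>X(f)\<close> have to cancel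
  for this: for \<nabla>T through the Leibniz rule of the connection, for \<alpha> through the
  symmetry of the second fundamental form. Both Levi-Civita connections are then pinned down by one
  algebraic uniqueness argument, \<open>D0\<close> by comparison with the ambient derivative and
  \<open>D\<close> by comparison with its own transport under \<tau>.\<close>

lemma k_smooth_on_cong:
  assumes "open S" "\<And>x. x \<in> S \<Longrightarrow> f x = g x" "k_smooth_on k S f"
  shows "k_smooth_on k S g"
  using assms(2,3)
proof (induction k arbitrary: f g)
  case 0
  then show ?case by (simp cong: continuous_on_cong)
next
  case (Suc k)
  have der: "(g has_derivative frechet_derivative f (at x)) (at x)" if x: "x \<in> S" for x
  proof -
    have "(f has_derivative frechet_derivative f (at x)) (at x)"
      using Suc.prems(2) x frechet_derivative_works by auto
    then show ?thesis
      by (rule has_derivative_transform_within_open[OF _ assms(1) x]) (use Suc.prems in auto)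
  qed
  have "k_smooth_on k S (\<lambda>x. frechet_derivative g (at x) v)" for v
  proof (rule Suc.IH)
    show "k_smooth_on k S (\<lambda>x. frechet_derivative f (at x) v)"
      using Suc.prems by simp
  qed (use der in \<open>metis frechet_derivative_at\<close>)
  with der show ?case by (auto simp: differentiable_def)
qed

text \<open>Since S is open, derivatives at its points are unique, so any formula for the derivative
  may stand in for the choice operator \<open>frechet_derivative\<close>.\<close>

lemma k_smooth_on_SucI:
  assumes "open S" "\<And>x. x \<in> S \<Longrightarrow> (f has_derivative f' x) (at x)"
    and "\<And>v. k_smooth_on k S (\<lambda>x. f' x v)"
  shows "k_smooth_on (Suc k) S f"
proof -
  have eq: "f' x v = frechet_derivative f (at x) v" if "x \<in> S" for x v
    using assms(2)[OF that] by (metis frechet_derivative_at)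
  have "f differentiable (at x)" if "x \<in> S" for x
    using assms(2)[OF that] by (auto simp: differentiable_def)
  moreover have "k_smooth_on k S (\<lambda>x. frechet_derivative f (at x) v)" for v
    by (rule k_smooth_on_cong[OF assms(1) eq assms(3)])
  ultimately show ?thesis by simp
qed

lemma k_smooth_on_SucD:
  assumes "k_smooth_on (Suc k) S f"
  shows "x \<in> S \<Longrightarrow> (f has_derivative frechet_derivative f (at x)) (at x)"
    and "k_smooth_on k S (\<lambda>x. frechet_derivative f (at x) v)"
  using assms frechet_derivative_works by auto

text \<open>Product and chain rules mix a function with its derivative; this brings both to the same
  order, so that the induction hypotheses apply.\<close>

lemma k_smooth_on_lower: "k_smooth_on (Suc k) S f \<Longrightarrow> k_smooth_on k S f"
proof (induction k arbitrary: f)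
  case 0
  then show ?case
    by (auto intro!: differentiable_imp_continuous_on differentiable_at_imp_differentiable_on)
next
  case (Suc k)
  then show ?case by (metis k_smooth_on.simps(2))
qed

lemma k_smooth_on_subset: "k_smooth_on k S f \<Longrightarrow> T \<subseteq> S \<Longrightarrow> k_smooth_on k T f"
  by (induction k arbitrary: f) (auto intro: continuous_on_subset)

lemma k_smooth_on_local:
  assumes "\<And>x. x \<in> S \<Longrightarrow> \<exists>T. open T \<and> x \<in> T \<and> k_smooth_on k T f"
  shows "k_smooth_on k S f"
  using assms
proof (induction k arbitrary: f)
  case 0
  then show ?case
    by (metis k_smooth_on.simps(1) continuous_at_imp_continuous_on continuous_on_eq_continuous_at)
next
  case (Suc k)
  have "f differentiable (at x)" if "x \<in> S" for x
    using Suc.prems[OF that] by auto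
  moreover have "k_smooth_on k S (\<lambda>x. frechet_derivative f (at x) v)" for v
    by (rule Suc.IH) (use Suc.prems in fastforce)
  ultimately show ?case by simp
qed

lemma k_smooth_on_const: "open S \<Longrightarrow> k_smooth_on k S (\<lambda>x. c)"
proof (induction k arbitrary: c)
  case (Suc k)
  then show ?case
    by (intro k_smooth_on_SucI[where f' = "\<lambda>x v. 0"]) auto
qed simp

lemma k_smooth_on_bounded_linear:
  assumes "bounded_linear L" "open S"
  shows "k_smooth_on k S L"
proof (cases k)
  case 0
  then show ?thesis
    by (simp add: assms(1) linear_continuous_on)
next
  case (Suc j)
  show ?thesis
    unfolding Suc
    by (rule k_smooth_on_SucI[OF assms(2) bounded_linear_imp_has_derivative[OF assms(1)]])
      (rule k_smooth_on_const[OF assms(2)])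
qed

lemma k_smooth_on_add:
  assumes "open S" "k_smooth_on k S f" "k_smooth_on k S g"
  shows "k_smooth_on k S (\<lambda>x. f x + g x)"
  using assms(2,3)
proof (induction k arbitrary: f g)
  case 0
  then show ?case by (auto intro: continuous_on_add)
next
  case (Suc k)
  note D = k_smooth_on_SucD[OF Suc.prems(1)] k_smooth_on_SucD[OF Suc.prems(2)]
  show ?case
    by (rule k_smooth_on_SucI[OF assms(1) has_derivative_add[OF D(1) D(3)]])
      (auto intro: Suc.IH D assms(1))
qed

lemma k_smooth_on_bilinear:
  assumes "bounded_bilinear B" "open S" "k_smooth_on k S f" "k_smooth_on k S g"
  shows "k_smooth_on k S (\<lambda>x. B (f x) (g x))"
  using assms(3,4)
proof (induction k arbitrary: f g)
  case 0
  then show ?case using bounded_bilinear.continuous_on[OF assms(1)] by simp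
next
  case (Suc k)
  note D = k_smooth_on_SucD[OF Suc.prems(1)] k_smooth_on_SucD[OF Suc.prems(2)]
  show ?case
    by (rule k_smooth_on_SucI[OF assms(2) bounded_bilinear.FDERIV[OF assms(1) D(1) D(3)]])
      (auto intro!: k_smooth_on_add Suc.IH D k_smooth_on_lower[OF Suc.prems(1)]
        k_smooth_on_lower[OF Suc.prems(2)] assms)
qed

lemma k_smooth_on_sum:
  assumes "open S" "finite I" "\<And>i. i \<in> I \<Longrightarrow> k_smooth_on k S (f i)"
  shows "k_smooth_on k S (\<lambda>x. \<Sum>i\<in>I. f i x)"
  using assms(2,3)
  by (induction I rule: finite_induct) (auto intro: k_smooth_on_const k_smooth_on_add assms(1))

text \<open>In the chain rule the direction \<open>f' x v\<close> varies with x, whereas the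
  definition of smoothness differentiates in fixed directions. Expanding that direction in a basis
  leaves only fixed directions with smooth coefficients, hence the Euclidean middle space.\<close>

lemma k_smooth_on_compose:
  fixes g :: "'b::euclidean_space \<Rightarrow> 'c::real_normed_vector"
  assumes "open S" "f ` S \<subseteq> T" "k_smooth_on k S f" "k_smooth_on k T g"
  shows "k_smooth_on k S (\<lambda>x. g (f x))"
  using assms(3,4)
proof (induction k arbitrary: g)
  case 0
  then show ?case
    using assms(2) by (auto intro: continuous_on_compose2)
next
  case (Suc k)
  note D = k_smooth_on_SucD[OF Suc.prems(1)] k_smooth_on_SucD[OF Suc.prems(2)]
  let ?f' = "\<lambda>x. frechet_derivative f (at x)" and ?g' = "\<lambda>y. frechet_derivative g (at y)"
  have g: "(g has_derivative ?g' (f x)) (at (f x))" if "x \<in> S" for x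
    using D(3) that assms(2) by auto
  show ?case
  proof (rule k_smooth_on_SucI[OF assms(1)])
    fix x assume x: "x \<in> S"
    have "((\<lambda>x. g (f x)) has_derivative (\<lambda>v. ?g' (f x) (?f' x v))) (at x)"
      using diff_chain_at[OF D(1)[OF x] g[OF x]] by (simp add: o_def)
    moreover have "?g' (f x) (?f' x v) = (\<Sum>b\<in>Basis. (?f' x v \<bullet> b) *\<^sub>R ?g' (f x) b)" for v
    proof -
      have l: "linear (?g' (f x))"
        using g[OF x] has_derivative_linear by blast
      have "?g' (f x) (?f' x v) = ?g' (f x) (\<Sum>b\<in>Basis. (?f' x v \<bullet> b) *\<^sub>R b)"
        by (simp add: euclidean_representation)
      then show ?thesis by (simp add: linear_sum[OF l] linear_cmul[OF l])
    qed
    ultimately show "((\<lambda>x. g (f x)) has_derivative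
        (\<lambda>v. \<Sum>b\<in>Basis. (?f' x v \<bullet> b) *\<^sub>R ?g' (f x) b)) (at x)"
      by simp
  next
    fix v
    show "k_smooth_on k S (\<lambda>x. \<Sum>b\<in>Basis. (?f' x v \<bullet> b) *\<^sub>R ?g' (f x) b)"
    proof (intro k_smooth_on_sum assms(1) finite_Basis
        k_smooth_on_bilinear[OF bounded_bilinear_scaleR])
      fix b :: 'b
      show "k_smooth_on k S (\<lambda>x. ?f' x v \<bullet> b)"
        by (intro k_smooth_on_bilinear[OF bounded_bilinear_inner] assms(1) D(2) k_smooth_on_const)
      show "k_smooth_on k S (\<lambda>x. ?g' (f x) b)"
        by (rule Suc.IH[OF k_smooth_on_lower[OF Suc.prems(1)] D(4)])
    qed
  qed
qed

text \<open>The derivative of 1/f is a product of 1/f with the derivative of f, so the induction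
  closes for one fixed f. Writing the sign as the factor -1 lets the product rule cover the whole
  expression.\<close>

lemma k_smooth_on_inverse:
  fixes f :: "'a::real_normed_vector \<Rightarrow> real"
  assumes "open S" "\<And>x. x \<in> S \<Longrightarrow> f x \<noteq> 0" "k_smooth_on k S f"
  shows "k_smooth_on k S (\<lambda>x. inverse (f x))"
  using assms(3)
proof (induction k)
  case 0
  then show ?case using assms(2) by (auto intro: continuous_on_inverse)
next
  case (Suc k)
  note D = k_smooth_on_SucD[OF Suc.prems]
  have i: "k_smooth_on k S (\<lambda>x. inverse (f x))"
    by (rule Suc.IH[OF k_smooth_on_lower[OF Suc.prems]])
  show ?case
  proof (rule k_smooth_on_SucI[OF assms(1)])
    show "((\<lambda>x. inverse (f x)) has_derivative
        (\<lambda>v. (-1) * (inverse (f x) * (frechet_derivative f (at x) v * inverse (f x))))) (at x)"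
      if "x \<in> S" for x
      using Deriv.has_derivative_inverse[OF assms(2)[OF that] D(1)[OF that]] by (simp add: mult.assoc)
    show "k_smooth_on k S
        (\<lambda>x. (-1) * (inverse (f x) * (frechet_derivative f (at x) v * inverse (f x))))" for v
      by (intro k_smooth_on_bilinear[OF bounded_bilinear_mult] assms(1) i D(2) k_smooth_on_const)
  qed
qed

section \<open>Closure properties of smoothness of all orders\<close>

lemma smooth_on_cong: "open S \<Longrightarrow> (\<And>x. x \<in> S \<Longrightarrow> f x = g x) \<Longrightarrow> smooth_on S f \<Longrightarrow> smooth_on S g"
  unfolding smooth_on_def using k_smooth_on_cong by blast

lemma smooth_on_subset: "smooth_on S f \<Longrightarrow> T \<subseteq> S \<Longrightarrow> smooth_on T f"
  unfolding smooth_on_def using k_smooth_on_subset by blast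

lemma smooth_on_local:
  assumes "\<And>x. x \<in> S \<Longrightarrow> \<exists>T. open T \<and> x \<in> T \<and> smooth_on T f"
  shows "smooth_on S f"
  unfolding smooth_on_def
proof
  fix k show "k_smooth_on k S f"
    by (rule k_smooth_on_local) (use assms in \<open>unfold smooth_on_def, blast\<close>)
qed

lemma smooth_on_const: "open S \<Longrightarrow> smooth_on S (\<lambda>x. c)"
  unfolding smooth_on_def using k_smooth_on_const by blast

lemma smooth_on_bounded_linear: "bounded_linear L \<Longrightarrow> open S \<Longrightarrow> smooth_on S L"
  unfolding smooth_on_def using k_smooth_on_bounded_linear by blast

lemma smooth_on_add:
  "open S \<Longrightarrow> smooth_on S f \<Longrightarrow> smooth_on S g \<Longrightarrow> smooth_on S (\<lambda>x. f x + g x)"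
  unfolding smooth_on_def using k_smooth_on_add by blast

lemma smooth_on_bilinear:
  "bounded_bilinear B \<Longrightarrow> open S \<Longrightarrow> smooth_on S f \<Longrightarrow> smooth_on S g \<Longrightarrow>
    smooth_on S (\<lambda>x. B (f x) (g x))"
  unfolding smooth_on_def using k_smooth_on_bilinear by blast

lemma smooth_on_sum:
  assumes "open S" "\<And>i. i \<in> I \<Longrightarrow> smooth_on S (f i)"
  shows "smooth_on S (\<lambda>x. \<Sum>i\<in>I. f i x)"
  using assms(2)
  by (induction I rule: infinite_finite_induct)
    (auto intro: smooth_on_const smooth_on_add assms(1))

lemma smooth_on_mult:
  fixes f g :: "'a::real_normed_vector \<Rightarrow> real"
  shows "open S \<Longrightarrow> smooth_on S f \<Longrightarrow> smooth_on S g \<Longrightarrow> smooth_on S (\<lambda>x. f x * g x)"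
  using smooth_on_bilinear[OF bounded_bilinear_mult] .

lemma smooth_on_prod:
  fixes f :: "'i \<Rightarrow> 'a::real_normed_vector \<Rightarrow> real"
  assumes "open S" "\<And>i. i \<in> I \<Longrightarrow> smooth_on S (f i)"
  shows "smooth_on S (\<lambda>x. \<Prod>i\<in>I. f i x)"
  using assms(2)
  by (induction I rule: infinite_finite_induct)
    (auto intro: smooth_on_const smooth_on_mult assms(1))

lemma smooth_on_divide:
  fixes f g :: "'a::real_normed_vector \<Rightarrow> real"
  assumes "open S" "\<And>x. x \<in> S \<Longrightarrow> g x \<noteq> 0" "smooth_on S f" "smooth_on S g"
  shows "smooth_on S (\<lambda>x. f x / g x)"
proof -
  have "smooth_on S (\<lambda>x. inverse (g x))"
    using k_smooth_on_inverse[OF assms(1,2)] assms(4) by (simp add: smooth_on_def)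
  from smooth_on_mult[OF assms(1,3) this] show ?thesis by (simp add: divide_inverse)
qed

lemma smooth_on_compose:
  fixes g :: "'b::euclidean_space \<Rightarrow> 'c::real_normed_vector"
  shows "open S \<Longrightarrow> f ` S \<subseteq> T \<Longrightarrow> smooth_on S f \<Longrightarrow> smooth_on T g \<Longrightarrow> smooth_on S (\<lambda>x. g (f x))"
  unfolding smooth_on_def using k_smooth_on_compose by blast

lemma smooth_on_has_derivative:
  assumes "smooth_on S f" "x \<in> S"
  shows "(f has_derivative frechet_derivative f (at x)) (at x)"
  using assms unfolding smooth_on_def by (meson k_smooth_on_SucD(1))

lemma smooth_on_derivative:
  "smooth_on S f \<Longrightarrow> smooth_on S (\<lambda>x. frechet_derivative f (at x) v)"
  unfolding smooth_on_def using k_smooth_on_SucD(2) by blast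

text \<open>A determinant is a polynomial in the entries. This prepares the quotients in Cramer's
  rule, which give the smoothness of the frame.\<close>

lemma smooth_on_det:
  fixes M :: "'a::real_normed_vector \<Rightarrow> real ^ 'n ^ 'n"
  assumes "open S" "\<And>i j. smooth_on S (\<lambda>x. M x $ i $ j)"
  shows "smooth_on S (\<lambda>x. det (M x))"
  unfolding det_def
  by (intro smooth_on_sum smooth_on_mult smooth_on_prod smooth_on_const assms)

section \<open>Tangent vectors and vector fields\<close>

text \<open>The coordinate form of a tangent vector: the directional derivative along v in the
  chart. The value 0 on functions not smooth at p follows the convention of
  \<open>tangent_space\<close>, so that equality of functionals can hold.\<close>

definition chart_tangent ::
    "('m::topological_space, 'n::finite) atlas \<Rightarrow> 'm set \<Rightarrow> ('m \<Rightarrow> real ^ 'n) \<Rightarrow> 'm \<Rightarrow>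
      real ^ 'n \<Rightarrow> 'm tvec"
  where "chart_tangent A U \<phi> p v =
    (\<lambda>f. if smooth_at A p f then frechet_derivative (f \<circ> inv_into U \<phi>) (at (\<phi> p)) v else 0)"

locale smooth_manifold =
  fixes A :: "('m::{t2_space, second_countable_topology}, 'n::finite) atlas"
  assumes atlas: "smooth_atlas A"
begin

lemma chart_exists:
  obtains U \<phi> where "(U, \<phi>) \<in> A" "p \<in> U"
proof -
  have "p \<in> (\<Union>(U, \<phi>)\<in>A. U)" using atlas by (simp add: smooth_atlas_def)
  then obtain c where "c \<in> A" "p \<in> fst c" by (auto simp: case_prod_unfold)
  then show ?thesis using that by (metis prod.collapse)
qed

lemma chart:
  assumes "(U, \<phi>) \<in> A"
  shows "open U" "open (\<phi> ` U)" "continuous_on U \<phi>" "continuous_on (\<phi> ` U) (inv_into U \<phi>)"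
    "q \<in> U \<Longrightarrow> inv_into U \<phi> (\<phi> q) = q"
proof -
  have "\<forall>(U, \<phi>)\<in>A. open U \<and> open (\<phi> ` U) \<and> homeomorphism U (\<phi> ` U) \<phi> (inv_into U \<phi>)"
    using atlas unfolding smooth_atlas_def by (elim conjE)
  from bspec[OF this assms]
  have "open U \<and> open (\<phi> ` U) \<and> homeomorphism U (\<phi> ` U) \<phi> (inv_into U \<phi>)"
    by simp
  then show "open U" "open (\<phi> ` U)" "continuous_on U \<phi>" "continuous_on (\<phi> ` U) (inv_into U \<phi>)"
    "q \<in> U \<Longrightarrow> inv_into U \<phi> (\<phi> q) = q"
    by (simp_all add: homeomorphism_def)
qed

lemma open_chart_image:
  assumes "(U, \<phi>) \<in> A" "open W"
  shows "open (\<phi> ` (U \<inter> W))"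
proof -
  have "\<phi> ` (U \<inter> W) = \<phi> ` U \<inter> inv_into U \<phi> -` W"
  proof (intro set_eqI iffI)
    fix x assume "x \<in> \<phi> ` (U \<inter> W)"
    then show "x \<in> \<phi> ` U \<inter> inv_into U \<phi> -` W"
      by (auto simp: chart(5)[OF assms(1)])
  next
    fix x assume "x \<in> \<phi> ` U \<inter> inv_into U \<phi> -` W"
    then show "x \<in> \<phi> ` (U \<inter> W)"
      by (auto simp: chart(5)[OF assms(1)])
  qed
  then show ?thesis
    using continuous_open_preimage[OF chart(4,2)[OF assms(1)] assms(2)] by simp
qed

lemma transition_smooth:
  "(U, \<phi>) \<in> A \<Longrightarrow> (V, \<psi>) \<in> A \<Longrightarrow> smooth_on (\<phi> ` (U \<inter> V)) (\<psi> \<circ> inv_into U \<phi>)"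
proof -
  have *: "\<forall>(U, \<phi>)\<in>A. \<forall>(V, \<psi>)\<in>A. smooth_on (\<phi> ` (U \<inter> V)) (\<psi> \<circ> inv_into U \<phi>)"
    using atlas unfolding smooth_atlas_def by (elim conjE)
  assume c: "(U, \<phi>) \<in> A" "(V, \<psi>) \<in> A"
  from bspec[OF * c(1)] have "\<forall>(V, \<psi>)\<in>A. smooth_on (\<phi> ` (U \<inter> V)) (\<psi> \<circ> inv_into U \<phi>)"
    by simp
  from bspec[OF this c(2)] show "smooth_on (\<phi> ` (U \<inter> V)) (\<psi> \<circ> inv_into U \<phi>)"
    by simp
qed

subsection \<open>Smooth functions\<close>

lemma smooth_fun_onI:
  "(\<And>U \<phi>. (U, \<phi>) \<in> A \<Longrightarrow> smooth_on (\<phi> ` (U \<inter> W)) (f \<circ> inv_into U \<phi>)) \<Longrightarrow> smooth_fun_on A W f"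
  unfolding smooth_fun_on_def by (intro ballI) (simp only: split_paired_all case_prod_conv)

lemma smooth_fun_onD:
  "smooth_fun_on A W f \<Longrightarrow> (U, \<phi>) \<in> A \<Longrightarrow> smooth_on (\<phi> ` (U \<inter> W)) (f \<circ> inv_into U \<phi>)"
  unfolding smooth_fun_on_def by (drule (1) bspec) simp

lemma smooth_fun_on_subset: "smooth_fun_on A W f \<Longrightarrow> V \<subseteq> W \<Longrightarrow> smooth_fun_on A V f"
  by (meson Int_mono image_mono order_refl smooth_fun_onD smooth_fun_onI smooth_on_subset)

lemma smooth_fun_on_cong:
  assumes "open W" "\<And>q. q \<in> W \<Longrightarrow> f q = g q" "smooth_fun_on A W f"
  shows "smooth_fun_on A W g"
proof (rule smooth_fun_onI)
  fix U \<phi> assume c: "(U, \<phi>) \<in> A"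
  show "smooth_on (\<phi> ` (U \<inter> W)) (g \<circ> inv_into U \<phi>)"
    by (rule smooth_on_cong[OF open_chart_image[OF c assms(1)] _ smooth_fun_onD[OF assms(3) c]])
      (auto simp: chart(5)[OF c] assms(2))
qed

lemma smooth_fun_on_const: "open W \<Longrightarrow> smooth_fun_on A W (\<lambda>q. c)"
  by (auto intro!: smooth_fun_onI smooth_on_const open_chart_image simp: o_def)

lemma smooth_fun_on_add:
  "open W \<Longrightarrow> smooth_fun_on A W f \<Longrightarrow> smooth_fun_on A W g \<Longrightarrow> smooth_fun_on A W (\<lambda>q. f q + g q)"
  by (rule smooth_fun_onI) (use smooth_on_add[OF open_chart_image] smooth_fun_onD in \<open>force simp: o_def\<close>)

lemma smooth_fun_on_mult:
  fixes f g :: "'m \<Rightarrow> real"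
  shows "open W \<Longrightarrow> smooth_fun_on A W f \<Longrightarrow> smooth_fun_on A W g \<Longrightarrow>
    smooth_fun_on A W (\<lambda>q. f q * g q)"
  by (rule smooth_fun_onI) (use smooth_on_mult[OF open_chart_image] smooth_fun_onD in \<open>force simp: o_def\<close>)

lemma smooth_fun_on_uminus:
  fixes f :: "'m \<Rightarrow> real"
  shows "open W \<Longrightarrow> smooth_fun_on A W f \<Longrightarrow> smooth_fun_on A W (\<lambda>q. - f q)"
  using smooth_fun_on_mult[of W "\<lambda>q. - 1" f] smooth_fun_on_const[of W "- 1"] by simp

lemma smooth_fun_on_diff:
  fixes f g :: "'m \<Rightarrow> real"
  shows "open W \<Longrightarrow> smooth_fun_on A W f \<Longrightarrow> smooth_fun_on A W g \<Longrightarrow>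
    smooth_fun_on A W (\<lambda>q. f q - g q)"
  using smooth_fun_on_add[of W f "\<lambda>q. - g q"] smooth_fun_on_uminus[of W g] by simp

lemma smooth_fun_on_sum:
  assumes "open W" "\<And>i. i \<in> I \<Longrightarrow> smooth_fun_on A W (f i)"
  shows "smooth_fun_on A W (\<lambda>q. \<Sum>i\<in>I. f i q)"
  using assms(2)
  by (induction I rule: infinite_finite_induct)
    (auto intro: smooth_fun_on_const smooth_fun_on_add assms(1))

lemma smooth_fun_on_component:
  fixes F :: "'m \<Rightarrow> real ^ 'k::finite"
  assumes "open W" "smooth_fun_on A W F"
  shows "smooth_fun_on A W (\<lambda>q. F q $ a)"
proof (rule smooth_fun_onI)
  fix U \<phi> assume c: "(U, \<phi>) \<in> A"
  show "smooth_on (\<phi> ` (U \<inter> W)) ((\<lambda>q. F q $ a) \<circ> inv_into U \<phi>)"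
    using smooth_on_compose[OF open_chart_image[OF c assms(1)] subset_UNIV
        smooth_fun_onD[OF assms(2) c] smooth_on_bounded_linear[OF bounded_linear_vec_nth open_UNIV]]
    by (simp add: o_def)
qed

lemma smooth_atI: "smooth_fun_on A W f \<Longrightarrow> open W \<Longrightarrow> p \<in> W \<Longrightarrow> smooth_at A p f"
  unfolding smooth_at_def by blast

lemma smooth_at_binary:
  assumes "smooth_at A p f" "smooth_at A p g"
    and "\<And>W. open W \<Longrightarrow> smooth_fun_on A W f \<Longrightarrow> smooth_fun_on A W g \<Longrightarrow> smooth_fun_on A W h"
  shows "smooth_at A p h"
proof -
  obtain V W where "open V" "p \<in> V" "smooth_fun_on A V f" "open W" "p \<in> W" "smooth_fun_on A W g"
    using assms(1,2) unfolding smooth_at_def by blast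
  then show ?thesis
    by (intro smooth_atI[of "V \<inter> W"] assms(3)) (auto intro: smooth_fun_on_subset)
qed

lemma smooth_at_add: "smooth_at A p f \<Longrightarrow> smooth_at A p g \<Longrightarrow> smooth_at A p (\<lambda>q. f q + g q)"
  by (rule smooth_at_binary[OF _ _ smooth_fun_on_add])

lemma smooth_at_mult:
  fixes f g :: "'m \<Rightarrow> real"
  shows "smooth_at A p f \<Longrightarrow> smooth_at A p g \<Longrightarrow> smooth_at A p (\<lambda>q. f q * g q)"
  by (rule smooth_at_binary[OF _ _ smooth_fun_on_mult])

lemma chart_has_derivative:
  assumes "(U, \<phi>) \<in> A" "p \<in> U" "smooth_at A p f"
  shows "((f \<circ> inv_into U \<phi>) has_derivative frechet_derivative (f \<circ> inv_into U \<phi>) (at (\<phi> p)))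
    (at (\<phi> p))"
proof -
  obtain W where "p \<in> W" "smooth_fun_on A W f"
    using assms(3) unfolding smooth_at_def by blast
  then show ?thesis
    using smooth_on_has_derivative[OF smooth_fun_onD[OF _ assms(1)]] assms(2) by blast
qed

subsection \<open>Tangent spaces\<close>

text \<open>By the chain rule through the chart, the curve matters only through its coordinate
  velocity at 0.\<close>

lemma chart_tangent_curve:
  assumes c: "(U, \<phi>) \<in> A" and p: "p \<in> U" and "smooth_curve_through A p \<gamma>"
    and f: "smooth_at A p f"
  shows "deriv (f \<circ> \<gamma>) 0 =
    frechet_derivative (f \<circ> inv_into U \<phi>) (at (\<phi> p)) (frechet_derivative (\<phi> \<circ> \<gamma>) (at 0) 1)"
proof -
  obtain e where e: "\<gamma> 0 = p" "e > 0" "continuous_on {-e<..<e} \<gamma>"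
    and "\<forall>(U, \<phi>)\<in>A. smooth_on ({-e<..<e} \<inter> \<gamma> -` U) (\<phi> \<circ> \<gamma>)"
    using assms(3) unfolding smooth_curve_through_def by (elim conjE exE)
  from bspec[OF this(4) c] have sm: "smooth_on ({-e<..<e} \<inter> \<gamma> -` U) (\<phi> \<circ> \<gamma>)" by simp
  \<comment> \<open>The curve may leave the chart domain; continuity leaves an open set of times
    around 0 on which coordinates make sense.\<close>
  let ?S = "{-e<..<e} \<inter> \<gamma> -` U"
  have S: "open ?S" "0 \<in> ?S"
    using continuous_open_preimage[OF e(3) _ chart(1)[OF c]] e p by auto
  let ?L = "frechet_derivative (f \<circ> inv_into U \<phi>) (at (\<phi> p))"
  let ?G = "frechet_derivative (\<phi> \<circ> \<gamma>) (at 0)"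
  have G: "((\<phi> \<circ> \<gamma>) has_derivative ?G) (at 0)"
    by (rule smooth_on_has_derivative[OF sm S(2)])
  have L: "((f \<circ> inv_into U \<phi>) has_derivative ?L) (at (\<phi> p))"
    by (rule chart_has_derivative[OF c p f])
  have "((f \<circ> inv_into U \<phi>) \<circ> (\<phi> \<circ> \<gamma>) has_derivative ?L \<circ> ?G) (at 0)"
    by (rule diff_chain_at[OF G]) (use L e(1) in simp)
  then have "(f \<circ> \<gamma> has_derivative ?L \<circ> ?G) (at 0)"
    by (rule has_derivative_transform_within_open[OF _ S]) (simp add: chart(5)[OF c])
  moreover have "(?L \<circ> ?G) = (*) (?L (?G 1))"
  proof
    fix t :: real
    have "?G (t *\<^sub>R 1) = t *\<^sub>R ?G 1"
      using G has_derivative_linear linear_cmul by blast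
    moreover have "?L (t *\<^sub>R ?G 1) = t *\<^sub>R ?L (?G 1)"
      using L has_derivative_linear linear_cmul by blast
    ultimately show "(?L \<circ> ?G) t = ?L (?G 1) * t" by simp
  qed
  ultimately show ?thesis
    by (auto intro!: DERIV_imp_deriv simp: has_field_derivative_def)
qed

text \<open>The curve is a straight line in coordinates, kept to times so short that it stays inside
  the open chart image.\<close>

lemma curve_with_velocity:
  assumes c: "(U, \<phi>) \<in> A" and p: "p \<in> U"
  obtains \<gamma> where "smooth_curve_through A p \<gamma>" "frechet_derivative (\<phi> \<circ> \<gamma>) (at 0) 1 = v"
proof -
  define l where "l t = \<phi> p + t *\<^sub>R v" for t :: real
  define \<gamma> where "\<gamma> t = inv_into U \<phi> (l t)" for t
  have contl: "continuous_on T l" for T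
    unfolding l_def by (intro continuous_intros)
  have "open (l -` (\<phi> ` U))"
    using open_vimage[OF chart(2)[OF c] contl] .
  moreover have "0 \<in> l -` (\<phi> ` U)" using p by (simp add: l_def)
  ultimately obtain e where e: "e > 0" "{-e<..<e} \<subseteq> l -` (\<phi> ` U)"
    using open_contains_ball[of "l -` (\<phi> ` U)"] by (force simp: ball_eq_greaterThanLessThan)
  have lU: "l t \<in> \<phi> ` U" if "t \<in> {-e<..<e}" for t using e that by blast
  have inv: "\<phi> (\<gamma> t) = l t" if "t \<in> {-e<..<e}" for t
    using lU[OF that] by (simp add: \<gamma>_def f_inv_into_f)
  have \<gamma>U: "\<gamma> t \<in> U" if "t \<in> {-e<..<e}" for t
    using lU[OF that] by (simp add: \<gamma>_def inv_into_into)
  have \<gamma>0: "\<gamma> 0 = p" using p c by (simp add: \<gamma>_def l_def chart(5))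
  have cont: "continuous_on {-e<..<e} \<gamma>"
    unfolding \<gamma>_def using e(2) by (intro continuous_on_compose2[OF chart(4)[OF c] contl]) auto
  have "smooth_on ({-e<..<e} \<inter> \<gamma> -` V) (\<psi> \<circ> \<gamma>)" if "(V, \<psi>) \<in> A" for V \<psi>
  proof -
    let ?S = "{-e<..<e} \<inter> \<gamma> -` V"
    have S: "open ?S" using continuous_open_preimage[OF cont _ chart(1)[OF that]] by simp
    have "smooth_on ?S (\<lambda>t. \<phi> p + t *\<^sub>R v)"
      by (intro smooth_on_add smooth_on_const S smooth_on_bounded_linear bounded_linear_scaleR_left)
    moreover have "(\<lambda>t. \<phi> p + t *\<^sub>R v) ` ?S \<subseteq> \<phi> ` (U \<inter> V)"
    proof (rule image_subsetI)
      fix t assume t: "t \<in> ?S"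
      then have "\<phi> (\<gamma> t) = \<phi> p + t *\<^sub>R v" using inv by (simp add: l_def)
      then show "\<phi> p + t *\<^sub>R v \<in> \<phi> ` (U \<inter> V)" using \<gamma>U t by (metis IntD1 IntD2 IntI imageI vimageD)
    qed
    ultimately have "smooth_on ?S (\<lambda>t. (\<psi> \<circ> inv_into U \<phi>) (\<phi> p + t *\<^sub>R v))"
      using smooth_on_compose[OF S _ _ transition_smooth[OF c that]] by blast
    then show ?thesis by (simp add: o_def \<gamma>_def l_def)
  qed
  then have "smooth_curve_through A p \<gamma>"
    unfolding smooth_curve_through_def using \<gamma>0 e(1) cont by (intro conjI exI[of _ e]) auto
  moreover have "frechet_derivative (\<phi> \<circ> \<gamma>) (at 0) 1 = v"
  proof -
    have "(l has_derivative (\<lambda>t. t *\<^sub>R v)) (at 0)"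
      unfolding l_def by (auto intro!: derivative_eq_intros)
    then have "(\<phi> \<circ> \<gamma> has_derivative (\<lambda>t. t *\<^sub>R v)) (at 0)"
      by (rule has_derivative_transform_within_open[of _ _ _ _ "{-e<..<e}"]) (use e inv in auto)
    then show ?thesis by (metis frechet_derivative_at scaleR_one)
  qed
  ultimately show ?thesis using that by blast
qed

text \<open>Curves cannot be added, so the linear structure of the tangent space has to be imported
  from the coordinate space.\<close>

lemma tangent_space_chart:
  assumes "(U, \<phi>) \<in> A" "p \<in> U"
  shows "tangent_space A p = range (chart_tangent A U \<phi> p)"
proof (intro set_eqI iffI)
  fix x assume "x \<in> tangent_space A p"
  then obtain \<gamma> where \<gamma>: "smooth_curve_through A p \<gamma>"
    "x = (\<lambda>f. if smooth_at A p f then deriv (f \<circ> \<gamma>) 0 else 0)"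
    unfolding tangent_space_def by blast
  then have "x = chart_tangent A U \<phi> p (frechet_derivative (\<phi> \<circ> \<gamma>) (at 0) 1)"
    by (auto simp: chart_tangent_def chart_tangent_curve[OF assms \<gamma>(1)])
  then show "x \<in> range (chart_tangent A U \<phi> p)" by blast
next
  fix x assume "x \<in> range (chart_tangent A U \<phi> p)"
  then obtain v where v: "x = chart_tangent A U \<phi> p v" by blast
  obtain \<gamma> where \<gamma>: "smooth_curve_through A p \<gamma>" "frechet_derivative (\<phi> \<circ> \<gamma>) (at 0) 1 = v"
    using curve_with_velocity[OF assms] .
  then have "x = (\<lambda>f. if smooth_at A p f then deriv (f \<circ> \<gamma>) 0 else 0)"
    by (auto simp: v chart_tangent_def chart_tangent_curve[OF assms \<gamma>(1)])
  with \<gamma>(1) show "x \<in> tangent_space A p" unfolding tangent_space_def by blast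
qed

lemma chart_tangent_linear:
  assumes "(U, \<phi>) \<in> A" "p \<in> U"
  shows "chart_tangent A U \<phi> p (v + w) = chart_tangent A U \<phi> p v + chart_tangent A U \<phi> p w"
    and "chart_tangent A U \<phi> p (r *\<^sub>R v) = tscale r (chart_tangent A U \<phi> p v)"
proof -
  have lin: "linear (frechet_derivative (f \<circ> inv_into U \<phi>) (at (\<phi> p)))" if "smooth_at A p f" for f :: "'m \<Rightarrow> real"
    using chart_has_derivative[OF assms that] has_derivative_linear by blast
  show "chart_tangent A U \<phi> p (v + w) = chart_tangent A U \<phi> p v + chart_tangent A U \<phi> p w"
    by (auto simp: chart_tangent_def fun_eq_iff linear_add[OF lin])
  show "chart_tangent A U \<phi> p (r *\<^sub>R v) = tscale r (chart_tangent A U \<phi> p v)"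
    by (auto simp: chart_tangent_def fun_eq_iff tscale_def linear_cmul[OF lin])
qed

lemma tangent_add:
  assumes "x \<in> tangent_space A p" "y \<in> tangent_space A p"
  shows "x + y \<in> tangent_space A p"
proof -
  obtain U \<phi> where c: "(U, \<phi>) \<in> A" "p \<in> U" by (rule chart_exists)
  then obtain v w where "x = chart_tangent A U \<phi> p v" "y = chart_tangent A U \<phi> p w"
    using assms by (auto simp: tangent_space_chart)
  then have "x + y = chart_tangent A U \<phi> p (v + w)"
    by (simp only: chart_tangent_linear(1)[OF c])
  then show ?thesis using tangent_space_chart[OF c] by blast
qed

lemma tangent_scale:
  assumes "x \<in> tangent_space A p"
  shows "tscale r x \<in> tangent_space A p"
proof -
  obtain U \<phi> where c: "(U, \<phi>) \<in> A" "p \<in> U" by (rule chart_exists)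
  then obtain v where "x = chart_tangent A U \<phi> p v"
    using assms by (auto simp: tangent_space_chart)
  then have "tscale r x = chart_tangent A U \<phi> p (r *\<^sub>R v)"
    by (simp only: chart_tangent_linear(2)[OF c])
  then show ?thesis using tangent_space_chart[OF c] by blast
qed

lemma tangent_zero: "0 \<in> tangent_space A p"
proof -
  obtain U \<phi> where c: "(U, \<phi>) \<in> A" "p \<in> U" by (rule chart_exists)
  \<comment> \<open>The argument is written as \<open>0 *\<^sub>R 0\<close> so that homogeneity
    alone yields the zero functional.\<close>
  have "chart_tangent A U \<phi> p (0 *\<^sub>R 0) = 0"
    unfolding chart_tangent_linear(2)[OF c] by (simp add: tscale_def zero_fun_def)
  then show ?thesis unfolding tangent_space_chart[OF c] by (metis rangeI)
qed

lemma tangent_diff: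
  assumes "x \<in> tangent_space A p" "y \<in> tangent_space A p"
  shows "x - y \<in> tangent_space A p"
proof -
  have "x + tscale (-1) y \<in> tangent_space A p"
    by (intro tangent_add tangent_scale assms)
  moreover have "x + tscale (-1) y = x - y" by (simp add: fun_eq_iff tscale_def)
  ultimately show ?thesis by simp
qed

lemma tangent_lincomb:
  assumes "finite I" "\<And>i. i \<in> I \<Longrightarrow> x i \<in> tangent_space A p"
  shows "(\<lambda>f. \<Sum>i\<in>I. c i * x i f) \<in> tangent_space A p"
  using assms
proof (induction I rule: finite_induct)
  case empty
  then show ?case using tangent_zero by (simp add: zero_fun_def)
next
  case (insert i I)
  have "(\<lambda>f. \<Sum>j\<in>insert i I. c j * x j f) = tscale (c i) (x i) + (\<lambda>f. \<Sum>j\<in>I. c j * x j f)"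
    using insert.hyps by (simp add: fun_eq_iff tscale_def)
  moreover have "tscale (c i) (x i) + (\<lambda>f. \<Sum>j\<in>I. c j * x j f) \<in> tangent_space A p"
    by (intro tangent_add tangent_scale insert.IH insert.prems) auto
  ultimately show ?case by simp
qed

section \<open>Tangent vectors as derivations\<close>

lemma tangent_fun_add:
  assumes x: "x \<in> tangent_space A p" and fg: "smooth_at A p f" "smooth_at A p g"
  shows "x (\<lambda>q. f q + g q) = x f + x g"
proof -
  obtain U \<phi> where c: "(U, \<phi>) \<in> A" "p \<in> U" by (rule chart_exists)
  then obtain v where v: "x = chart_tangent A U \<phi> p v"
    using x by (auto simp: tangent_space_chart)
  have "((\<lambda>q. f q + g q) \<circ> inv_into U \<phi> has_derivative
      (\<lambda>v. frechet_derivative (f \<circ> inv_into U \<phi>) (at (\<phi> p)) v +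
        frechet_derivative (g \<circ> inv_into U \<phi>) (at (\<phi> p)) v)) (at (\<phi> p))"
    using has_derivative_add[OF chart_has_derivative[OF c fg(1)] chart_has_derivative[OF c fg(2)]]
    by (simp add: o_def)
  from frechet_derivative_at[OF this, symmetric]
  show ?thesis using fg smooth_at_add[OF fg] by (simp add: v chart_tangent_def)
qed

lemma tangent_fun_mult:
  assumes x: "x \<in> tangent_space A p" and fg: "smooth_at A p f" "smooth_at A p g"
  shows "x (\<lambda>q. f q * g q) = x f * g p + f p * x g"
proof -
  obtain U \<phi> where c: "(U, \<phi>) \<in> A" "p \<in> U" by (rule chart_exists)
  then obtain v where v: "x = chart_tangent A U \<phi> p v"
    using x by (auto simp: tangent_space_chart)
  have "((\<lambda>q. f q * g q) \<circ> inv_into U \<phi> has_derivative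
      (\<lambda>v. f p * frechet_derivative (g \<circ> inv_into U \<phi>) (at (\<phi> p)) v +
        frechet_derivative (f \<circ> inv_into U \<phi>) (at (\<phi> p)) v * g p)) (at (\<phi> p))"
    using has_derivative_mult[OF chart_has_derivative[OF c fg(1)] chart_has_derivative[OF c fg(2)]]
    by (simp add: o_def chart(5)[OF c])
  from frechet_derivative_at[OF this, symmetric]
  show ?thesis using fg smooth_at_mult[OF fg] by (simp add: v chart_tangent_def)
qed

lemma tangent_fun_const:
  assumes x: "x \<in> tangent_space A p"
  shows "x (\<lambda>q. r) = 0"
proof -
  obtain U \<phi> where c: "(U, \<phi>) \<in> A" "p \<in> U" by (rule chart_exists)
  then obtain v where v: "x = chart_tangent A U \<phi> p v"
    using x by (auto simp: tangent_space_chart)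
  show ?thesis
    by (simp add: v chart_tangent_def o_def)
qed

lemma tangent_fun_cmult:
  assumes x: "x \<in> tangent_space A p" and "smooth_at A p f"
  shows "x (\<lambda>q. r * f q) = r * x f"
proof -
  have "smooth_at A p (\<lambda>q. r)"
    by (rule smooth_atI[OF smooth_fun_on_const[OF open_UNIV] open_UNIV UNIV_I])
  from tangent_fun_mult[OF x this assms(2)] show ?thesis by (simp add: tangent_fun_const[OF x])
qed

lemma tangent_fun_uminus:
  assumes x: "x \<in> tangent_space A p" and "smooth_at A p f"
  shows "x (\<lambda>q. - f q) = - x f"
  using tangent_fun_cmult[OF assms, of "-1"] by simp

lemma tangent_fun_sum:
  assumes x: "x \<in> tangent_space A p" and "finite I" "\<And>i. i \<in> I \<Longrightarrow> smooth_fun_on A UNIV (f i)"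
  shows "x (\<lambda>q. \<Sum>i\<in>I. f i q) = (\<Sum>i\<in>I. x (f i))"
  using assms(2,3)
proof (induction I rule: finite_induct)
  case empty
  then show ?case using tangent_fun_const[OF x] by simp
next
  case (insert i I)
  have "x (\<lambda>q. f i q + (\<Sum>j\<in>I. f j q)) = x (f i) + x (\<lambda>q. \<Sum>j\<in>I. f j q)"
    by (rule tangent_fun_add[OF x])
      (rule smooth_atI[OF _ open_UNIV UNIV_I], auto intro: smooth_fun_on_sum insert)+
  then show ?case using insert by simp
qed

subsection \<open>Vector fields\<close>

lemma vector_fieldI:
  "(\<And>p. X p \<in> tangent_space A p) \<Longrightarrow>
    (\<And>W f. open W \<Longrightarrow> smooth_fun_on A W f \<Longrightarrow> smooth_fun_on A W (\<lambda>q. X q f)) \<Longrightarrow>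
    X \<in> vector_fields A"
  unfolding vector_fields_def by (intro CollectI conjI allI impI)

lemma vector_field_tangent: "X \<in> vector_fields A \<Longrightarrow> X p \<in> tangent_space A p"
  unfolding vector_fields_def by simp

lemma vector_field_smooth:
  "X \<in> vector_fields A \<Longrightarrow> open W \<Longrightarrow> smooth_fun_on A W f \<Longrightarrow> smooth_fun_on A W (\<lambda>q. X q f)"
  unfolding vector_fields_def by simp

lemma vector_field_lincomb:
  assumes "\<And>i. i \<in> I \<Longrightarrow> X i \<in> vector_fields A" "\<And>i. i \<in> I \<Longrightarrow> smooth_fun_on A UNIV (c i)"
    "finite I"
  shows "(\<lambda>q f. \<Sum>i\<in>I. c i q * X i q f) \<in> vector_fields A"
proof (rule vector_fieldI)
  show "(\<lambda>f. \<Sum>i\<in>I. c i p * X i p f) \<in> tangent_space A p" for p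
    by (rule tangent_lincomb[OF assms(3) vector_field_tangent[OF assms(1)]])
next
  fix W and f :: "'m \<Rightarrow> real" assume W: "open W" "smooth_fun_on A W f"
  show "smooth_fun_on A W (\<lambda>q. \<Sum>i\<in>I. c i q * X i q f)"
  proof (rule smooth_fun_on_sum[OF W(1)])
    fix i assume i: "i \<in> I"
    show "smooth_fun_on A W (\<lambda>q. c i q * X i q f)"
      by (rule smooth_fun_on_mult[OF W(1) smooth_fun_on_subset[OF assms(2)[OF i] subset_UNIV]
            vector_field_smooth[OF assms(1)[OF i] W]])
  qed
qed

lemma vector_field_zero: "0 \<in> vector_fields A"
  by (rule vector_fieldI) (simp_all add: tangent_zero smooth_fun_on_const)

lemma vector_field_scale:
  assumes "X \<in> vector_fields A" "smooth_fun_on A UNIV f"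
  shows "(\<lambda>q. tscale (f q) (X q)) \<in> vector_fields A"
  using vector_field_lincomb[of "{()}" "\<lambda>_. X" "\<lambda>_. f"] assms by (simp add: tscale_def)

subsection \<open>Smooth self-maps\<close>

lemma smooth_self_map_open_preimage: "smooth_self_map A \<tau> \<Longrightarrow> open W \<Longrightarrow> open (\<tau> -` W)"
  unfolding smooth_self_map_def by (elim conjE) (rule open_vimage)

lemma smooth_self_map_chart:
  assumes "smooth_self_map A \<tau>" "(U, \<phi>) \<in> A" "(V, \<psi>) \<in> A"
  shows "smooth_on (\<phi> ` (U \<inter> \<tau> -` V)) (\<psi> \<circ> \<tau> \<circ> inv_into U \<phi>)"
proof -
  have "\<forall>(U, \<phi>)\<in>A. \<forall>(V, \<psi>)\<in>A. smooth_on (\<phi> ` (U \<inter> \<tau> -` V)) (\<psi> \<circ> \<tau> \<circ> inv_into U \<phi>)"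
    using assms(1) unfolding smooth_self_map_def by (elim conjE)
  from bspec[OF this assms(2)] have "\<forall>(V, \<psi>)\<in>A. smooth_on (\<phi> ` (U \<inter> \<tau> -` V)) (\<psi> \<circ> \<tau> \<circ> inv_into U \<phi>)"
    by simp
  from bspec[OF this assms(3)] show ?thesis by simp
qed

text \<open>Smoothness of \<tau> is known only between pairs of charts. Near each point a chart
  around its image is inserted, and the composition is smooth there by the chain rule; smoothness
  being local, this suffices.\<close>

lemma smooth_fun_on_comp_self_map:
  fixes f :: "'m \<Rightarrow> real"
  assumes \<tau>: "smooth_self_map A \<tau>" and W: "open W" and f: "smooth_fun_on A W f"
  shows "smooth_fun_on A (\<tau> -` W) (f \<circ> \<tau>)"
proof (rule smooth_fun_onI, rule smooth_on_local)
  fix U \<phi> x assume c: "(U, \<phi>) \<in> A" and "x \<in> \<phi> ` (U \<inter> \<tau> -` W)"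
  then obtain q where q: "q \<in> U" "\<tau> q \<in> W" "x = \<phi> q" by blast
  obtain V \<psi> where d: "(V, \<psi>) \<in> A" "\<tau> q \<in> V" by (rule chart_exists)
  let ?T = "\<phi> ` (U \<inter> \<tau> -` (V \<inter> W))"
  have T: "open ?T"
    by (intro open_chart_image[OF c] smooth_self_map_open_preimage[OF \<tau>] open_Int chart(1)[OF d(1)] W)
  have 1: "smooth_on ?T (\<psi> \<circ> \<tau> \<circ> inv_into U \<phi>)"
    by (rule smooth_on_subset[OF smooth_self_map_chart[OF \<tau> c d(1)]]) auto
  have 2: "(\<psi> \<circ> \<tau> \<circ> inv_into U \<phi>) ` ?T \<subseteq> \<psi> ` (V \<inter> W)"
    using chart(5)[OF c] by auto
  have "smooth_on ?T (\<lambda>x. (f \<circ> inv_into V \<psi>) ((\<psi> \<circ> \<tau> \<circ> inv_into U \<phi>) x))"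
    by (rule smooth_on_compose[OF T 2 1 smooth_fun_onD[OF f d(1)]])
  then have "smooth_on ?T (f \<circ> \<tau> \<circ> inv_into U \<phi>)"
    by (rule smooth_on_cong[OF T, rotated]) (auto simp: chart(5)[OF c] chart(5)[OF d(1)])
  then show "\<exists>T. open T \<and> x \<in> T \<and> smooth_on T (f \<circ> \<tau> \<circ> inv_into U \<phi>)"
    using T q d by blast
qed

lemma smooth_at_comp_self_map:
  fixes f :: "'m \<Rightarrow> real"
  assumes \<tau>: "smooth_self_map A \<tau>" and "smooth_at A (\<tau> p) f"
  shows "smooth_at A p (f \<circ> \<tau>)"
proof -
  obtain W where W: "open W" "\<tau> p \<in> W" "smooth_fun_on A W f"
    using assms(2) unfolding smooth_at_def by blast
  show ?thesis
    by (rule smooth_atI[OF smooth_fun_on_comp_self_map[OF \<tau> W(1,3)]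
          smooth_self_map_open_preimage[OF \<tau> W(1)]]) (use W(2) in simp)
qed

text \<open>In charts the image vector is the Jacobian of \<tau> applied to the coordinates of x, so
  it again has the coordinate form of a tangent vector.\<close>

lemma differential_tangent:
  assumes \<tau>: "smooth_self_map A \<tau>" and x: "x \<in> tangent_space A p"
  shows "differential A \<tau> p x \<in> tangent_space A (\<tau> p)"
proof -
  obtain U \<phi> where c: "(U, \<phi>) \<in> A" "p \<in> U" by (rule chart_exists)
  then obtain v where v: "x = chart_tangent A U \<phi> p v"
    using x by (auto simp: tangent_space_chart)
  obtain V \<psi> where d: "(V, \<psi>) \<in> A" "\<tau> p \<in> V" by (rule chart_exists)
  let ?h = "\<psi> \<circ> \<tau> \<circ> inv_into U \<phi>"
  let ?L = "frechet_derivative ?h (at (\<phi> p))"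
  have cont: "open (\<tau> -` V)"
    by (rule smooth_self_map_open_preimage[OF \<tau> chart(1)[OF d(1)]])
  have h: "(?h has_derivative ?L) (at (\<phi> p))"
    by (rule smooth_on_has_derivative[OF smooth_self_map_chart[OF \<tau> c(1) d(1)]]) (use c d in auto)
  have "differential A \<tau> p x f = chart_tangent A V \<psi> (\<tau> p) (?L v) f" for f
  proof (cases "smooth_at A (\<tau> p) f")
    case True
    let ?G = "frechet_derivative (f \<circ> inv_into V \<psi>) (at (\<psi> (\<tau> p)))"
    have "(f \<circ> inv_into V \<psi> \<circ> ?h has_derivative ?G \<circ> ?L) (at (\<phi> p))"
      by (rule diff_chain_at[OF h]) (simp add: chart(5)[OF c] chart_has_derivative[OF d True])
    then have "(f \<circ> \<tau> \<circ> inv_into U \<phi> has_derivative ?G \<circ> ?L) (at (\<phi> p))"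
      by (rule has_derivative_transform_within_open[OF _ open_chart_image[OF c(1) cont]])
        (use c d in \<open>auto simp: chart(5)[OF c(1)] chart(5)[OF d(1)]\<close>)
    from frechet_derivative_at[OF this, symmetric]
    show ?thesis
      using True smooth_at_comp_self_map[OF \<tau> True]
      by (simp add: differential_def v chart_tangent_def)
  next
    case False
    then show ?thesis by (simp add: differential_def chart_tangent_def)
  qed
  then show ?thesis using tangent_space_chart[OF d] by blast
qed

end

context smooth_manifold
begin

subsection \<open>Coordinate vector fields\<close>

lemma chart_tangent_in: "(U, \<phi>) \<in> A \<Longrightarrow> p \<in> U \<Longrightarrow> chart_tangent A U \<phi> p v \<in> tangent_space A p"
  by (simp add: tangent_space_chart)

text \<open>No smoothness of f is assumed: where f is not smooth at p, both sides are 0 by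
  convention.\<close>

lemma chart_tangent_expansion:
  assumes c: "(U, \<phi>) \<in> A" "p \<in> U"
  shows "chart_tangent A U \<phi> p v f = (\<Sum>i\<in>UNIV. v $ i * chart_tangent A U \<phi> p (axis i 1) f)"
proof (cases "smooth_at A p f")
  case True
  let ?L = "frechet_derivative (f \<circ> inv_into U \<phi>) (at (\<phi> p))"
  have lin: "linear ?L"
    using chart_has_derivative[OF c True] has_derivative_linear by blast
  have "?L v = ?L (\<Sum>i\<in>UNIV. (v $ i) *\<^sub>R axis i 1)"
    using basis_expansion[of v] by (simp add: scalar_mult_eq_scaleR)
  also have "\<dots> = (\<Sum>i\<in>UNIV. v $ i * ?L (axis i 1))"
    by (simp add: linear_sum[OF lin] linear_cmul[OF lin])
  finally show ?thesis using True by (simp add: chart_tangent_def)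
qed (simp add: chart_tangent_def)

lemma chart_component_smooth_at:
  assumes c: "(U, \<phi>) \<in> A" "p \<in> U"
  shows "smooth_at A p (\<lambda>q. \<phi> q $ i)"
proof -
  have "smooth_fun_on A U (\<lambda>q. \<phi> q $ i)"
  proof (rule smooth_fun_onI)
    fix V \<psi> assume d: "(V, \<psi>) \<in> A"
    have "smooth_on (\<psi> ` (V \<inter> U)) (\<lambda>x. (\<phi> \<circ> inv_into V \<psi>) x $ i)"
      by (rule smooth_on_compose[OF open_chart_image[OF d chart(1)[OF c(1)]] subset_UNIV
            transition_smooth[OF d c(1)] smooth_on_bounded_linear[OF bounded_linear_vec_nth open_UNIV]])
    then show "smooth_on (\<psi> ` (V \<inter> U)) ((\<lambda>q. \<phi> q $ i) \<circ> inv_into V \<psi>)"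
      by (simp add: o_def)
  qed
  then show ?thesis using chart(1)[OF c(1)] c(2) by (rule smooth_atI)
qed

lemma chart_tangent_component:
  assumes c: "(U, \<phi>) \<in> A" "p \<in> U"
  shows "chart_tangent A U \<phi> p v (\<lambda>q. \<phi> q $ i) = v $ i"
proof -
  have "((\<lambda>x. x $ i) has_derivative (\<lambda>x. x $ i)) (at (\<phi> p))"
    by (rule bounded_linear_imp_has_derivative[OF bounded_linear_vec_nth])
  then have "((\<lambda>q. \<phi> q $ i) \<circ> inv_into U \<phi> has_derivative (\<lambda>x. x $ i)) (at (\<phi> p))"
    by (rule has_derivative_transform_within_open[OF _ chart(2)[OF c(1)]])
      (use c in \<open>auto simp: chart(5)[OF c(1)]\<close>)
  from frechet_derivative_at[OF this, symmetric] show ?thesis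
    using chart_component_smooth_at[OF c] by (simp add: chart_tangent_def)
qed

text \<open>Applying the functional to the coordinate functions recovers the components of
  v.\<close>

lemma chart_tangent_inj:
  assumes c: "(U, \<phi>) \<in> A" "p \<in> U"
    and eq: "chart_tangent A U \<phi> p v = chart_tangent A U \<phi> p w"
  shows "v = w"
proof -
  have "v $ i = w $ i" for i
    using fun_cong[OF eq, of "\<lambda>q. \<phi> q $ i"] by (simp add: chart_tangent_component[OF c])
  then show ?thesis by (simp add: vec_eq_iff)
qed

lemma chart_tangent_smooth:
  fixes f :: "'m \<Rightarrow> real"
  assumes c: "(U, \<phi>) \<in> A" and W: "open W" "smooth_fun_on A W f"
  shows "smooth_on (\<phi> ` (U \<inter> W)) (\<lambda>x. chart_tangent A U \<phi> (inv_into U \<phi> x) v f)"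
proof (rule smooth_on_cong[OF open_chart_image[OF c W(1)] _
      smooth_on_derivative[OF smooth_fun_onD[OF W(2) c], of v]])
  fix x assume "x \<in> \<phi> ` (U \<inter> W)"
  then obtain q where q: "q \<in> U" "q \<in> W" "x = \<phi> q" by blast
  then have "smooth_at A q f" using W by (auto intro: smooth_atI)
  with q show "frechet_derivative (f \<circ> inv_into U \<phi>) (at x) v =
      chart_tangent A U \<phi> (inv_into U \<phi> x) v f"
    by (simp add: chart_tangent_def chart(5)[OF c])
qed

end

section \<open>Hypersurfaces of the sphere\<close>

locale sphere_hypersurface = smooth_manifold A
  for A :: "('m::{t2_space, second_countable_topology}, 'n::finite) atlas" +
  fixes F N :: "'m \<Rightarrow> real ^ 'k::finite"
  assumes codimension: "CARD('k) = CARD('n) + 2"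
    and embedding: "sphere_embedding A F"
    and normal: "unit_normal_field A F N"
begin

section \<open>Orthogonality relations between \<open>F\<close>, \<open>N\<close> and their
  differentials\<close>

lemma F_smooth: "smooth_fun_on A UNIV (\<lambda>q. F q $ b)"
  using embedding smooth_fun_on_component[OF open_UNIV, of F b] by (simp add: sphere_embedding_def)

lemma N_smooth: "smooth_fun_on A UNIV (\<lambda>q. N q $ b)"
  using normal smooth_fun_on_component[OF open_UNIV, of N b] by (simp add: unit_normal_field_def)

lemma smooth_everywhere: "smooth_fun_on A UNIV f \<Longrightarrow> smooth_at A p f"
  by (rule smooth_atI[OF _ open_UNIV UNIV_I])

lemma F_inner: "F p \<bullet> F p = 1" and N_inner: "N p \<bullet> N p = 1" and N_F_inner: "N p \<bullet> F p = 0"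
  using embedding normal by (simp_all add: sphere_embedding_def unit_normal_field_def norm_eq_1)

lemma F_sum: "(\<Sum>b\<in>UNIV. F p $ b * F p $ b) = 1"
  and N_sum: "(\<Sum>b\<in>UNIV. N p $ b * N p $ b) = 1"
  and N_F_sum: "(\<Sum>b\<in>UNIV. N p $ b * F p $ b) = 0"
  using F_inner[of p] N_inner[of p] N_F_inner[of p] by (simp_all add: inner_vec_def)

lemma vdiff_inner: "vdiff G x \<bullet> vdiff H y = (\<Sum>b\<in>UNIV. x (\<lambda>q. G q $ b) * y (\<lambda>q. H q $ b))"
  by (simp add: vdiff_def inner_vec_def)

text \<open>Since \<open>F\<close> is an immersion, tangent vectors need only be compared on the
  components of \<open>F\<close>. Most identities between tangent vectors below are verified this
  way.\<close>

lemma tangent_eqI: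
  assumes "x \<in> tangent_space A p" "y \<in> tangent_space A p"
    and "\<And>b. x (\<lambda>q. F q $ b) = y (\<lambda>q. F q $ b)"
  shows "x = y"
proof -
  have "inj_on (vdiff F) (tangent_space A p)" using embedding by (simp add: sphere_embedding_def)
  moreover have "vdiff F x = vdiff F y" using assms(3) by (simp add: vdiff_def)
  ultimately show ?thesis using assms(1,2) by (rule inj_onD)
qed

lemma tangent_sum_mult:
  fixes f g :: "'k \<Rightarrow> 'm \<Rightarrow> real"
  assumes x: "x \<in> tangent_space A p"
    and "\<And>b. smooth_fun_on A UNIV (f b)" "\<And>b. smooth_fun_on A UNIV (g b)"
  shows "x (\<lambda>q. \<Sum>b\<in>UNIV. f b q * g b q) =
    (\<Sum>b\<in>UNIV. x (f b) * g b p) + (\<Sum>b\<in>UNIV. f b p * x (g b))"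
proof -
  have "x (\<lambda>q. \<Sum>b\<in>UNIV. f b q * g b q) = (\<Sum>b\<in>UNIV. x (\<lambda>q. f b q * g b q))"
    by (rule tangent_fun_sum[OF x finite smooth_fun_on_mult[OF open_UNIV assms(2,3)]])
  also have "\<dots> = (\<Sum>b\<in>UNIV. x (f b) * g b p + f b p * x (g b))"
    by (simp add: tangent_fun_mult[OF x smooth_everywhere smooth_everywhere] assms(2,3))
  finally show ?thesis by (simp add: sum.distrib)
qed

lemma N_dF:
  assumes "x \<in> tangent_space A p"
  shows "(\<Sum>b\<in>UNIV. N p $ b * x (\<lambda>q. F q $ b)) = 0"
  using normal assms unfolding unit_normal_field_def by (simp add: vdiff_def inner_vec_def)

text \<open>Obtained by differentiating |F|^2 = 1. The next two relations come likewise from |N|^2 =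
  1 and from <N, F> = 0; the latter also uses that \<open>N\<close> is normal.\<close>

lemma F_dF:
  assumes x: "x \<in> tangent_space A p"
  shows "(\<Sum>b\<in>UNIV. F p $ b * x (\<lambda>q. F q $ b)) = 0"
  using tangent_sum_mult[OF x, of "\<lambda>b q. F q $ b" "\<lambda>b q. F q $ b", OF F_smooth F_smooth] tangent_fun_const[OF x, of 1]
  by (simp add: F_sum mult.commute)

lemma N_dN:
  assumes x: "x \<in> tangent_space A p"
  shows "(\<Sum>b\<in>UNIV. N p $ b * x (\<lambda>q. N q $ b)) = 0"
  using tangent_sum_mult[OF x, of "\<lambda>b q. N q $ b" "\<lambda>b q. N q $ b", OF N_smooth N_smooth] tangent_fun_const[OF x, of 1]
  by (simp add: N_sum mult.commute)

lemma F_dN: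
  assumes x: "x \<in> tangent_space A p"
  shows "(\<Sum>b\<in>UNIV. F p $ b * x (\<lambda>q. N q $ b)) = 0"
  using tangent_sum_mult[OF x, of "\<lambda>b q. N q $ b" "\<lambda>b q. F q $ b", OF N_smooth F_smooth] tangent_fun_const[OF x, of 0] N_dF[OF x]
  by (simp add: N_F_sum mult.commute[of "F p $ _"])

text \<open>Dimension count: the image of dF has dimension n and lies in the orthogonal complement
  of the plane spanned by \<open>F p\<close> and \<open>N p\<close>, whose dimension is (n + 2) - 2.
  Hence the two subspaces agree.\<close>

lemma tangent_vector_exists:
  assumes "v \<bullet> F p = 0" "v \<bullet> N p = 0"
  shows "\<exists>x\<in>tangent_space A p. vdiff F x = v"
proof -
  obtain U \<phi> where c: "(U, \<phi>) \<in> A" "p \<in> U" by (rule chart_exists)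
  define L where "L w = vdiff F (chart_tangent A U \<phi> p w)" for w
  have lin: "linear L"
    by (rule linearI) (simp_all add: L_def vdiff_def vec_eq_iff chart_tangent_linear[OF c] tscale_def)
  have "inj L"
  proof (rule injI)
    fix w w' assume "L w = L w'"
    then have "chart_tangent A U \<phi> p w = chart_tangent A U \<phi> p w'"
      by (intro tangent_eqI[OF chart_tangent_in[OF c] chart_tangent_in[OF c]])
        (simp add: L_def vdiff_def vec_eq_iff)
    then show "w = w'" by (rule chart_tangent_inj[OF c])
  qed
  then have "dim (range L) = CARD('n)"
    using dim_image_eq[OF lin, of UNIV] by simp
  let ?S = "span {F p, N p}"
  let ?B = "{y \<in> UNIV. \<forall>x\<in>?S. orthogonal x y}"
  have "F p \<noteq> N p" "F p \<noteq> 0" "N p \<noteq> 0"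
    using F_inner[of p] N_inner[of p] N_F_inner[of p] by auto
  then have "pairwise orthogonal {F p, N p}" "0 \<notin> {F p, N p}"
    using N_F_inner[of p] by (auto simp: pairwise_def orthogonal_def inner_commute)
  then have "independent {F p, N p}" by (rule pairwise_orthogonal_independent)
  then have "dim ?S = 2" using \<open>F p \<noteq> N p\<close> by (simp add: dim_eq_card_independent)
  then have "dim ?B = CARD('n)"
    using dim_subspace_orthogonal_to_vectors[OF subspace_span subspace_UNIV subset_UNIV, of "{F p, N p}"]
      codimension by simp
  have B: "?B = {y. y \<bullet> F p = 0 \<and> y \<bullet> N p = 0}"
  proof (intro set_eqI iffI)
    fix y assume "y \<in> ?B"
    then show "y \<in> {y. y \<bullet> F p = 0 \<and> y \<bullet> N p = 0}"
      using span_base[of _ "{F p, N p}"] by (auto simp: orthogonal_def inner_commute)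
  next
    fix y assume "y \<in> {y. y \<bullet> F p = 0 \<and> y \<bullet> N p = 0}"
    then have "orthogonal y x" if "x \<in> ?S" for x
      using orthogonal_to_span[OF that, of y] by (auto simp: orthogonal_def)
    then show "y \<in> ?B" by (simp add: orthogonal_commute)
  qed
  have "range L \<subseteq> ?B"
    unfolding B using N_dF[OF chart_tangent_in[OF c]] F_dF[OF chart_tangent_in[OF c]]
    by (auto simp: L_def vdiff_def inner_vec_def mult.commute)
  moreover have "subspace ?B"
    unfolding B by (auto simp: subspace_def inner_add_left)
  ultimately have "range L = ?B"
    using \<open>dim (range L) = _\<close> \<open>dim ?B = _\<close> linear_subspace_image[OF lin subspace_UNIV]
    by (intro subspace_dim_equal) auto
  then have "v \<in> range L" unfolding B using assms by simp
  then show ?thesis using chart_tangent_in[OF c] by (auto simp: L_def)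
qed

subsection \<open>A global frame\<close>

text \<open>The tangential projection of the constant vector field \<open>e\<^sub>a\<close>.\<close>

definition frame :: "'k \<Rightarrow> 'm vfield"
  where "frame a p = (SOME x. x \<in> tangent_space A p \<and>
    vdiff F x = axis a 1 - (F p $ a) *\<^sub>R F p - (N p $ a) *\<^sub>R N p)"

lemma frame_tangent: "frame a p \<in> tangent_space A p"
  and frame_F: "frame a p (\<lambda>q. F q $ b) =
    (if b = a then 1 else 0) - F p $ a * F p $ b - N p $ a * N p $ b"
proof -
  let ?v = "axis a 1 - (F p $ a) *\<^sub>R F p - (N p $ a) *\<^sub>R N p"
  have "\<exists>x\<in>tangent_space A p. vdiff F x = ?v"
    by (rule tangent_vector_exists)
      (simp_all add: inner_diff_left inner_axis_axis inner_axis' F_inner N_inner N_F_inner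
        inner_commute[of "F p" "N p"])
  then have "\<exists>x. x \<in> tangent_space A p \<and> vdiff F x = ?v" by blast
  from someI_ex[OF this] have *: "frame a p \<in> tangent_space A p" "vdiff F (frame a p) = ?v"
    by (simp_all add: frame_def)
  show "frame a p \<in> tangent_space A p" by fact
  have "frame a p (\<lambda>q. F q $ b) = vdiff F (frame a p) $ b" by (simp add: vdiff_def)
  then show "frame a p (\<lambda>q. F q $ b) =
      (if b = a then 1 else 0) - F p $ a * F p $ b - N p $ a * N p $ b"
    unfolding *(2) by (simp add: axis_def)
qed

text \<open>The numbers \<open>frame a p (F_b)\<close> are the entries of I - F F^T - N N^T, the
  orthogonal projection onto the tangent space. It fixes v, and being symmetric it may be summed
  over either index.\<close>

lemma sum_frame_F:
  assumes "(\<Sum>b\<in>UNIV. F p $ b * v b) = 0" "(\<Sum>b\<in>UNIV. N p $ b * v b) = 0"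
  shows "(\<Sum>b\<in>UNIV. v b * frame b p (\<lambda>q. F q $ a)) = v a"
    and "(\<Sum>b\<in>UNIV. v b * frame a p (\<lambda>q. F q $ b)) = v a"
proof -
  have 1: "(\<Sum>b\<in>UNIV. v b * ((if b = a then 1 else 0) - F p $ a * F p $ b - N p $ a * N p $ b)) = v a"
  proof -
    have "(\<Sum>b\<in>UNIV. v b * ((if b = a then 1 else 0) - F p $ a * F p $ b - N p $ a * N p $ b)) =
        (\<Sum>b\<in>UNIV. (if b = a then v b else 0) - F p $ a * (F p $ b * v b) - N p $ a * (N p $ b * v b))"
      by (rule sum.cong) (auto simp: algebra_simps)
    then show ?thesis by (simp add: sum_subtractf sum_distrib_left[symmetric] assms)
  qed
  then show "(\<Sum>b\<in>UNIV. v b * frame a p (\<lambda>q. F q $ b)) = v a" by (simp add: frame_F)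
  have "(\<Sum>b\<in>UNIV. v b * frame b p (\<lambda>q. F q $ a)) =
      (\<Sum>b\<in>UNIV. v b * ((if b = a then 1 else 0) - F p $ a * F p $ b - N p $ a * N p $ b))"
    by (rule sum.cong) (auto simp: frame_F algebra_simps)
  then show "(\<Sum>b\<in>UNIV. v b * frame b p (\<lambda>q. F q $ a)) = v a" using 1 by simp
qed

text \<open>The frame is chosen point by point with \<open>SOME\<close>, so smoothness has to be
  recovered: its chart coordinates solve a linear system whose matrix is the Gram matrix of the
  induced metric, and Cramer's rule writes them as quotients of smooth determinants.\<close>

lemma frame_smooth_in_chart:
  fixes f :: "'m \<Rightarrow> real"
  assumes c: "(U, \<phi>) \<in> A" and W: "open W" "smooth_fun_on A W f"
  shows "smooth_on (\<phi> ` (U \<inter> W)) (\<lambda>x. frame a (inv_into U \<phi> x) f)"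
proof -
  let ?S = "\<phi> ` (U \<inter> W)"
  \<comment> \<open>\<open>P\<close> holds the components of dF on the coordinate fields and
    \<open>M\<close> is their Gram matrix; \<open>R\<close> is \<open>M\<close> with column k
    replaced by the right-hand side of the system, as Cramer's rule requires.\<close>
  define P where "P q i b = chart_tangent A U \<phi> q (axis i 1) (\<lambda>q. F q $ b)" for q i b
  define M where "M q = (\<chi> i j. \<Sum>b\<in>UNIV. P q i b * P q j b)" for q
  define R where "R q k = (\<chi> i j. if j = k then P q i a else M q $ i $ j)" for q k
  have S: "open ?S" by (rule open_chart_image[OF c W(1)])
  have P: "smooth_on ?S (\<lambda>x. P (inv_into U \<phi> x) i b)" for i b
    unfolding P_def
    by (rule chart_tangent_smooth[OF c W(1) smooth_fun_on_subset[OF F_smooth subset_UNIV]])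
  have M: "smooth_on ?S (\<lambda>x. M (inv_into U \<phi> x) $ i $ j)" for i j
    unfolding M_def by (simp, intro smooth_on_sum smooth_on_mult P S)
  have R: "smooth_on ?S (\<lambda>x. R (inv_into U \<phi> x) k $ i $ j)" for i j k
    using P M by (cases "j = k") (simp_all add: R_def)
  have det: "det (M q) \<noteq> 0" if q: "q \<in> U" for q
  proof -
    have "w = 0" if w: "M q *v w = 0" for w
    proof -
      have dF: "chart_tangent A U \<phi> q w (\<lambda>q. F q $ b) = (\<Sum>i\<in>UNIV. w $ i * P q i b)" for b
        unfolding P_def by (rule chart_tangent_expansion[OF c q])
      \<comment> \<open>The quadratic form of \<open>M\<close> at w is |dF w|^2, so a kernel vector
        is killed by the injective dF.\<close>
      have "0 = (\<Sum>i\<in>UNIV. w $ i * (M q *v w) $ i)" by (simp add: w)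
      also have "\<dots> = (\<Sum>i\<in>UNIV. \<Sum>j\<in>UNIV. \<Sum>b\<in>UNIV. (w $ i * P q i b) * (w $ j * P q j b))"
        by (simp add: matrix_vector_mult_def M_def sum_distrib_left sum_distrib_right mult_ac)
      also have "\<dots> = (\<Sum>i\<in>UNIV. \<Sum>b\<in>UNIV. \<Sum>j\<in>UNIV. (w $ i * P q i b) * (w $ j * P q j b))"
        by (intro sum.cong refl sum.swap)
      also have "\<dots> = (\<Sum>b\<in>UNIV. \<Sum>i\<in>UNIV. \<Sum>j\<in>UNIV. (w $ i * P q i b) * (w $ j * P q j b))"
        by (rule sum.swap)
      also have "\<dots> = (\<Sum>b\<in>UNIV. (chart_tangent A U \<phi> q w (\<lambda>q. F q $ b))\<^sup>2)"
        by (simp add: dF power2_eq_square sum_product)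
      finally have "(\<Sum>b\<in>UNIV. (chart_tangent A U \<phi> q w (\<lambda>q. F q $ b))\<^sup>2) = 0" by simp
      then have "chart_tangent A U \<phi> q w (\<lambda>q. F q $ b) = 0" for b
        by (simp add: sum_nonneg_eq_0_iff)
      moreover have "chart_tangent A U \<phi> q 0 (\<lambda>q. F q $ b) = 0" for b
        using chart_tangent_expansion[OF c q, of 0] by simp
      ultimately have "chart_tangent A U \<phi> q w = chart_tangent A U \<phi> q 0"
        by (intro tangent_eqI[OF chart_tangent_in[OF c q] chart_tangent_in[OF c q]]) simp
      then show "w = 0" by (rule chart_tangent_inj[OF c q])
    qed
    then show ?thesis
      using matrix_left_invertible_ker[of "M q"] invertible_left_inverse[of "M q"]
        invertible_det_nz[of "M q"] by blast
  qed
  have eq: "frame a q f = (\<Sum>k\<in>UNIV. det (R q k) / det (M q) * chart_tangent A U \<phi> q (axis k 1) f)"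
    if q: "q \<in> U" for q f
  proof -
    obtain u where u: "frame a q = chart_tangent A U \<phi> q u"
      using frame_tangent[of a q] tangent_space_chart[OF c q] by auto
    have "(M q *v u) $ i = P q i a" for i
    proof -
      have "(M q *v u) $ i = (\<Sum>j\<in>UNIV. \<Sum>b\<in>UNIV. P q i b * (u $ j * P q j b))"
        by (simp add: matrix_vector_mult_def M_def sum_distrib_left sum_distrib_right mult_ac)
      also have "\<dots> = (\<Sum>b\<in>UNIV. \<Sum>j\<in>UNIV. P q i b * (u $ j * P q j b))"
        by (rule sum.swap)
      also have "\<dots> = (\<Sum>b\<in>UNIV. P q i b * frame a q (\<lambda>q. F q $ b))"
        unfolding u chart_tangent_expansion[OF c q, of u] P_def by (simp add: sum_distrib_left)
      \<comment> \<open>dF of a coordinate field is tangent, so pairing it with the projection of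
        the a-th basis vector returns its a-th component.\<close>
      also have "\<dots> = P q i a"
        by (rule sum_frame_F(2)) (simp_all add: P_def F_dF N_dF chart_tangent_in[OF c q])
      finally show ?thesis .
    qed
    then have "R q k = (\<chi> i j. if j = k then (M q *v u) $ i else M q $ i $ j)" for k
      by (simp only: R_def)
    then have "u $ k = det (R q k) / det (M q)" for k
      using det[OF q] by (simp add: cramer_lemma)
    then show ?thesis unfolding u chart_tangent_expansion[OF c q, of u] by simp
  qed
  show ?thesis
  proof (rule smooth_on_cong[OF S])
    show "smooth_on ?S (\<lambda>x. \<Sum>k\<in>UNIV. det (R (inv_into U \<phi> x) k) / det (M (inv_into U \<phi> x)) *
        chart_tangent A U \<phi> (inv_into U \<phi> x) (axis k 1) f)"
      by (intro smooth_on_sum smooth_on_mult smooth_on_divide smooth_on_det S R M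
          chart_tangent_smooth[OF c W]) (auto simp: chart(5)[OF c] det)
  qed (auto simp: chart(5)[OF c] eq)
qed

lemma frame_field: "frame a \<in> vector_fields A"
proof (rule vector_fieldI[OF frame_tangent], rule smooth_fun_onI)
  fix W U \<phi> and f :: "'m \<Rightarrow> real"
  assume "open W" "smooth_fun_on A W f" "(U, \<phi>) \<in> A"
  then show "smooth_on (\<phi> ` (U \<inter> W)) ((\<lambda>q. frame a q f) \<circ> inv_into U \<phi>)"
    using frame_smooth_in_chart by (simp add: o_def)
qed

text \<open>The n + 2 frame fields are linearly dependent. The coefficients \<open>x(F_a)\<close>
  are a canonical choice: linear in x, and smooth when x runs along a vector field.\<close>

lemma frame_expansion:
  assumes x: "x \<in> tangent_space A p"
  shows "x = (\<lambda>f. \<Sum>a\<in>UNIV. x (\<lambda>q. F q $ a) * frame a p f)"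
  by (rule tangent_eqI[OF x tangent_lincomb[OF finite frame_tangent]])
    (simp add: sum_frame_F(1) F_dF[OF x] N_dF[OF x])

text \<open>Freezing the coefficients at p gives a global extension, with no cutoff
  function.\<close>

lemma vector_field_through:
  assumes x: "x \<in> tangent_space A p"
  obtains X where "X \<in> vector_fields A" "X p = x"
proof
  show "(\<lambda>q f. \<Sum>a\<in>UNIV. x (\<lambda>q. F q $ a) * frame a q f) \<in> vector_fields A"
    by (rule vector_field_lincomb[OF frame_field smooth_fun_on_const[OF open_UNIV] finite])
  show "(\<lambda>f. \<Sum>a\<in>UNIV. x (\<lambda>q. F q $ a) * frame a p f) = x"
    using frame_expansion[OF x] by (rule sym)
qed

lemma vector_fields_through:
  assumes "set xs \<subseteq> tangent_space A p"
  obtains Xs where "set Xs \<subseteq> vector_fields A" "map (\<lambda>X. X p) Xs = xs"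
proof -
  have "\<exists>Xs. set Xs \<subseteq> vector_fields A \<and> map (\<lambda>X. X p) Xs = xs"
    using assms
  proof (induction xs)
    case (Cons x xs)
    then obtain Xs where "set Xs \<subseteq> vector_fields A" "map (\<lambda>X. X p) Xs = xs" by auto
    moreover obtain X where "X \<in> vector_fields A" "X p = x"
      using vector_field_through[of x p] Cons.prems by auto
    ultimately show ?case by (intro exI[of _ "X # Xs"]) simp
  qed simp
  then show ?thesis using that by blast
qed

text \<open>The right-hand side involves X only through \<open>X p\<close>, so this is the criterion
  for independence of the extension. It applies because the coefficients in the frame expansion are
  smooth on all of the manifold.\<close>

lemma tensorial_expansion:
  fixes \<Phi> :: "'m vfield \<Rightarrow> real"
  assumes add: "\<And>X Y. X \<in> vector_fields A \<Longrightarrow> Y \<in> vector_fields A \<Longrightarrow> \<Phi> (X + Y) = \<Phi> X + \<Phi> Y"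
    and scale: "\<And>f X. smooth_fun_on A UNIV f \<Longrightarrow> X \<in> vector_fields A \<Longrightarrow>
      \<Phi> (\<lambda>q. tscale (f q) (X q)) = f p * \<Phi> X"
    and X: "X \<in> vector_fields A"
  shows "\<Phi> X = (\<Sum>a\<in>UNIV. X p (\<lambda>q. F q $ a) * \<Phi> (frame a))"
proof -
  have sm: "smooth_fun_on A UNIV (\<lambda>q. X q (\<lambda>q. F q $ a))" for a
    by (rule vector_field_smooth[OF X open_UNIV F_smooth])
  have "\<Phi> (\<lambda>q f. \<Sum>a\<in>I. X q (\<lambda>q. F q $ a) * frame a q f) =
      (\<Sum>a\<in>I. X p (\<lambda>q. F q $ a) * \<Phi> (frame a))" if "finite I" for I
    using that
  proof (induction I rule: finite_induct)
    case empty
    have "(\<lambda>q f. \<Sum>a\<in>{}. X q (\<lambda>q. F q $ a) * frame a q f) = 0"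
      by (simp add: fun_eq_iff)
    moreover have "\<Phi> 0 = 0" using add[OF vector_field_zero vector_field_zero] by simp
    ultimately show ?case by simp
  next
    case (insert a I)
    let ?Y = "\<lambda>q. tscale (X q (\<lambda>q. F q $ a)) (frame a q)"
    let ?Z = "\<lambda>q f. \<Sum>a\<in>I. X q (\<lambda>q. F q $ a) * frame a q f"
    have "(\<lambda>q f. \<Sum>a\<in>insert a I. X q (\<lambda>q. F q $ a) * frame a q f) = ?Y + ?Z"
      using insert.hyps by (simp add: fun_eq_iff tscale_def)
    moreover have "\<Phi> (?Y + ?Z) = \<Phi> ?Y + \<Phi> ?Z"
      by (rule add[OF vector_field_scale[OF frame_field sm]
            vector_field_lincomb[OF frame_field sm insert.hyps(1)]])
    ultimately show ?case
      using insert scale[OF sm frame_field] by simp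
  qed
  from this[OF finite]
  have "\<Phi> (\<lambda>q f. \<Sum>a\<in>UNIV. X q (\<lambda>q. F q $ a) * frame a q f) =
      (\<Sum>a\<in>UNIV. X p (\<lambda>q. F q $ a) * \<Phi> (frame a))" .
  moreover have "(\<lambda>q f. \<Sum>a\<in>UNIV. X q (\<lambda>q. F q $ a) * frame a q f) = X"
    by (rule ext) (rule frame_expansion[OF vector_field_tangent[OF X], symmetric])
  ultimately show ?thesis by simp
qed

end

section \<open>Connections and tensor fields\<close>

text \<open>The algebra behind uniqueness of the Levi-Civita connection: differences of torsion-free
  connections are symmetric in the first two slots, differences of metric ones are skew in the last
  two. Alternating the two swaps returns to the original triple after six steps, with three sign
  changes.\<close>

lemma symmetric_skew_eq_0:
  fixes B :: "'a \<Rightarrow> 'a \<Rightarrow> 'a \<Rightarrow> real"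
  assumes sym: "\<And>x y z. x \<in> S \<Longrightarrow> y \<in> S \<Longrightarrow> z \<in> S \<Longrightarrow> B x y z = B y x z"
    and skew: "\<And>x y z. x \<in> S \<Longrightarrow> y \<in> S \<Longrightarrow> z \<in> S \<Longrightarrow> B x y z = - B x z y"
    and "x \<in> S" "y \<in> S" "z \<in> S"
  shows "B x y z = 0"
proof -
  have "B x y z = - B x z y" "B x z y = B z x y" "B z x y = - B z y x"
    "B z y x = B y z x" "B y z x = - B y x z" "B y x z = B x y z"
    by (intro sym skew assms(3-5))+
  then show ?thesis by linarith
qed

context
  fixes A :: "('m::{t2_space, second_countable_topology}, 'n::finite) atlas"
    and h :: "'m \<Rightarrow> 'm tvec \<Rightarrow> 'm tvec \<Rightarrow> real"
    and D :: "'m vfield \<Rightarrow> 'm vfield \<Rightarrow> 'm vfield"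
  assumes D: "levi_civita A h D"
begin

lemma levi_civita_connection: "connection A D"
  using D by (simp add: levi_civita_def)

lemma levi_civita_torsion:
  assumes "X \<in> vector_fields A" "Y \<in> vector_fields A"
  shows "D X Y - D Y X = lie_bracket A X Y"
  using D assms unfolding levi_civita_def by simp

lemma levi_civita_metric:
  assumes "X \<in> vector_fields A" "Y \<in> vector_fields A" "Z \<in> vector_fields A"
  shows "X p (\<lambda>q. h q (Y q) (Z q)) = h p (D X Y p) (Z p) + h p (Y p) (D X Z p)"
  using D assms unfolding levi_civita_def by simp

end

lemma
  assumes "connection A D" "X \<in> vector_fields A" "Y \<in> vector_fields A"
  shows connection_field: "D X Y \<in> vector_fields A"
    and connection_add_left: "X' \<in> vector_fields A \<Longrightarrow> D (X + X') Y = D X Y + D X' Y"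
    and connection_add_right: "Y' \<in> vector_fields A \<Longrightarrow> D X (Y + Y') = D X Y + D X Y'"
    and connection_scale_left: "smooth_fun_on A UNIV f \<Longrightarrow>
      D (\<lambda>q. tscale (f q) (X q)) Y = (\<lambda>q. tscale (f q) (D X Y q))"
    and connection_scale_right: "smooth_fun_on A UNIV f \<Longrightarrow>
      D X (\<lambda>q. tscale (f q) (Y q)) = (\<lambda>q. tscale (X q f) (Y q) + tscale (f q) (D X Y q))"
  using assms unfolding connection_def by simp_all

text \<open>The smoothness clause is what allows T to be differentiated again. Both clauses are
  restricted to tangent arguments, because the values of a \<open>THE\<close>-defined tensor
  elsewhere are arbitrary.\<close>

definition tensor_field ::
    "('m::topological_space, 'n::finite) atlas \<Rightarrow> nat \<Rightarrow> 'm tensor \<Rightarrow> bool"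
  where "tensor_field A k T \<longleftrightarrow>
    (\<forall>p vs i x y c. length vs = k \<longrightarrow> set vs \<subseteq> tangent_space A p \<longrightarrow> i < k \<longrightarrow>
       x \<in> tangent_space A p \<longrightarrow> y \<in> tangent_space A p \<longrightarrow>
       T p (vs[i := x + y]) = T p (vs[i := x]) + T p (vs[i := y]) \<and>
       T p (vs[i := tscale c x]) = c * T p (vs[i := x])) \<and>
    (\<forall>Ys. length Ys = k \<longrightarrow> set Ys \<subseteq> vector_fields A \<longrightarrow>
       smooth_fun_on A UNIV (\<lambda>q. T q (map (\<lambda>Y. Y q) Ys)))"

lemma
  assumes "tensor_field A k T"
  shows tensor_field_add: "\<lbrakk>length vs = k; set vs \<subseteq> tangent_space A p; i < k;
      x \<in> tangent_space A p; y \<in> tangent_space A p\<rbrakk> \<Longrightarrow>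
      T p (vs[i := x + y]) = T p (vs[i := x]) + T p (vs[i := y])"
    and tensor_field_scale: "\<lbrakk>length vs = k; set vs \<subseteq> tangent_space A p; i < k;
      x \<in> tangent_space A p\<rbrakk> \<Longrightarrow>
      T p (vs[i := tscale c x]) = c * T p (vs[i := x])"
    and tensor_field_smooth: "length Ys = k \<Longrightarrow> set Ys \<subseteq> vector_fields A \<Longrightarrow>
      smooth_fun_on A UNIV (\<lambda>q. T q (map (\<lambda>Y. Y q) Ys))"
  using assms unfolding tensor_field_def by simp_all

text \<open>The right-hand side of the definition of \<open>\<nabla>T\<close>, for given extending vector fields.\<close>

definition cov_diff ::
    "('m vfield \<Rightarrow> 'm vfield \<Rightarrow> 'm vfield) \<Rightarrow> 'm tensor \<Rightarrow> 'm vfield \<Rightarrow> 'm vfield list \<Rightarrow> 'm \<Rightarrow> real"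
  where "cov_diff D T X Ys p = X p (\<lambda>q. T q (map (\<lambda>Y. Y q) Ys))
    - (\<Sum>i<length Ys. T p ((map (\<lambda>Y. Y p) Ys)[i := D X (Ys ! i) p]))"

context sphere_hypersurface
begin

subsection \<open>Covariant derivatives of tensor fields\<close>

lemma map_vector_fields_tangent:
  "set Ys \<subseteq> vector_fields A \<Longrightarrow> set (map (\<lambda>Y. Y p) Ys) \<subseteq> tangent_space A p"
  using vector_field_tangent by auto

lemma set_update_subset: "set xs \<subseteq> S \<Longrightarrow> x \<in> S \<Longrightarrow> set (xs[i := x]) \<subseteq> S"
  using set_update_subset_insert by fast

context
  fixes D :: "'m vfield \<Rightarrow> 'm vfield \<Rightarrow> 'm vfield" and T :: "'m tensor" and k :: nat
  assumes D: "connection A D" and T: "tensor_field A k T"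
begin

lemma D_tangent: "X \<in> vector_fields A \<Longrightarrow> Y \<in> vector_fields A \<Longrightarrow> D X Y p \<in> tangent_space A p"
  by (rule vector_field_tangent[OF connection_field[OF D]])

lemma cov_diff_expand_left:
  assumes Ys: "set Ys \<subseteq> vector_fields A" "length Ys = k" and X: "X \<in> vector_fields A"
  shows "cov_diff D T X Ys p = (\<Sum>a\<in>UNIV. X p (\<lambda>q. F q $ a) * cov_diff D T (frame a) Ys p)"
proof (rule tensorial_expansion[OF _ _ X])
  have Yi: "Ys ! i \<in> vector_fields A" if "i < length Ys" for i using that Ys nth_mem by blast
  note v = map_vector_fields_tangent[OF Ys(1), of p]
  show "cov_diff D T (X + Y) Ys p = cov_diff D T X Ys p + cov_diff D T Y Ys p"
    if X: "X \<in> vector_fields A" and Y: "Y \<in> vector_fields A" for X Y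
  proof -
    have "(\<Sum>i<length Ys. T p ((map (\<lambda>Y. Y p) Ys)[i := D (X + Y) (Ys ! i) p])) =
      (\<Sum>i<length Ys. T p ((map (\<lambda>Y. Y p) Ys)[i := D X (Ys ! i) p]) +
        T p ((map (\<lambda>Y. Y p) Ys)[i := D Y (Ys ! i) p]))"
      by (intro sum.cong refl)
        (simp add: connection_add_left[OF D X Yi Y] tensor_field_add[OF T _ v] Ys(2) D_tangent X Y Yi)
    then show ?thesis by (simp add: cov_diff_def sum.distrib)
  qed
  show "cov_diff D T (\<lambda>q. tscale (f q) (X q)) Ys p = f p * cov_diff D T X Ys p"
    if f: "smooth_fun_on A UNIV f" and X: "X \<in> vector_fields A" for f X
  proof -
    have "(\<Sum>i<length Ys. T p ((map (\<lambda>Y. Y p) Ys)[i := D (\<lambda>q. tscale (f q) (X q)) (Ys ! i) p])) =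
      (\<Sum>i<length Ys. f p * T p ((map (\<lambda>Y. Y p) Ys)[i := D X (Ys ! i) p]))"
      by (intro sum.cong refl)
        (simp add: connection_scale_left[OF D X Yi f] tensor_field_scale[OF T _ v] Ys(2) D_tangent X Yi)
    then show ?thesis
      by (simp add: cov_diff_def tscale_def right_diff_distrib sum_distrib_left)
  qed
qed

text \<open>Splits off the two terms in which the entry of slot j is differentiated; in the
  remaining sum it is merely inserted, after a different slot has been changed.\<close>

lemma cov_diff_update:
  assumes Ys: "length Ys = k" and j: "j < k"
  shows "cov_diff D T X (Ys[j := Y]) p =
    X p (\<lambda>q. T q ((map (\<lambda>Y. Y q) Ys)[j := Y q]))
    - T p ((map (\<lambda>Y. Y p) Ys)[j := D X Y p])
    - (\<Sum>i\<in>{..<k} - {j}. T p ((map (\<lambda>Y. Y p) Ys)[i := D X (Ys ! i) p, j := Y p]))"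
proof -
  let ?t = "\<lambda>i. T p ((map (\<lambda>Y. Y p) (Ys[j := Y]))[i := D X (Ys[j := Y] ! i) p])"
  have "(\<Sum>i<k. ?t i) = ?t j + (\<Sum>i\<in>{..<k} - {j}. ?t i)"
    using j by (intro sum.remove) auto
  moreover have "?t j = T p ((map (\<lambda>Y. Y p) Ys)[j := D X Y p])"
    using j Ys by (simp add: map_update)
  moreover have "(\<Sum>i\<in>{..<k} - {j}. ?t i) =
      (\<Sum>i\<in>{..<k} - {j}. T p ((map (\<lambda>Y. Y p) Ys)[i := D X (Ys ! i) p, j := Y p]))"
    by (intro sum.cong refl) (auto simp: map_update list_update_swap)
  ultimately show ?thesis using Ys by (simp add: cov_diff_def map_update)
qed

text \<open>For an entry fY the term X(f) T(..., Y, ...) arises twice: from differentiating the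
  function T(..., fY, ...) and, with opposite sign, from the Leibniz rule for the connection in slot
  j. The cancellation makes the expression linear over functions.\<close>

lemma cov_diff_expand_slot:
  assumes Ys: "set Ys \<subseteq> vector_fields A" "length Ys = k" and X: "X \<in> vector_fields A"
    and j: "j < k" and Y: "Y \<in> vector_fields A"
  shows "cov_diff D T X (Ys[j := Y]) p =
    (\<Sum>a\<in>UNIV. Y p (\<lambda>q. F q $ a) * cov_diff D T X (Ys[j := frame a]) p)"
proof (rule tensorial_expansion[OF _ _ Y])
  have len: "length (map (\<lambda>Y. Y q) Ys) = k" for q using Ys by simp
  note v = map_vector_fields_tangent[OF Ys(1)]
  let ?v = "\<lambda>i. (map (\<lambda>Y. Y p) Ys)[i := D X (Ys ! i) p]"
  have v': "length (?v i) = k" "set (?v i) \<subseteq> tangent_space A p" if "i < k" for i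
  proof -
    have "Ys ! i \<in> vector_fields A" using that Ys nth_mem by blast
    then show "set (?v i) \<subseteq> tangent_space A p" by (intro set_update_subset v D_tangent X)
  qed (use Ys in simp)
  have sm: "smooth_at A p (\<lambda>q. T q ((map (\<lambda>Y. Y q) Ys)[j := Y q]))"
    if "Y \<in> vector_fields A" for Y
  proof -
    have "smooth_fun_on A UNIV (\<lambda>q. T q (map (\<lambda>Y. Y q) (Ys[j := Y])))"
      using Ys that by (intro tensor_field_smooth[OF T] set_update_subset) auto
    then show ?thesis by (simp add: map_update smooth_everywhere)
  qed
  show "cov_diff D T X (Ys[j := Y + Z]) p =
      cov_diff D T X (Ys[j := Y]) p + cov_diff D T X (Ys[j := Z]) p"
    if Y: "Y \<in> vector_fields A" and Z: "Z \<in> vector_fields A" for Y Z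
  proof -
    have "(\<Sum>i\<in>{..<k} - {j}. T p ((?v i)[j := (Y + Z) p])) =
        (\<Sum>i\<in>{..<k} - {j}. T p ((?v i)[j := Y p]) + T p ((?v i)[j := Z p]))"
      by (intro sum.cong refl)
        (simp add: tensor_field_add[OF T v' j] vector_field_tangent Y Z)
    moreover have "T p ((map (\<lambda>Y. Y p) Ys)[j := D X (Y + Z) p]) =
        T p ((map (\<lambda>Y. Y p) Ys)[j := D X Y p]) + T p ((map (\<lambda>Y. Y p) Ys)[j := D X Z p])"
      by (simp add: connection_add_right[OF D X Y Z] tensor_field_add[OF T len v j] D_tangent X Y Z)
    moreover have "X p (\<lambda>q. T q ((map (\<lambda>Y. Y q) Ys)[j := (Y + Z) q])) =
        X p (\<lambda>q. T q ((map (\<lambda>Y. Y q) Ys)[j := Y q])) + X p (\<lambda>q. T q ((map (\<lambda>Y. Y q) Ys)[j := Z q]))"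
      by (simp add: tensor_field_add[OF T len v j] vector_field_tangent Y Z
          tangent_fun_add[OF vector_field_tangent[OF X] sm sm])
    ultimately show ?thesis
      by (simp only: cov_diff_update[OF Ys(2) j] sum.distrib)
  qed
  show "cov_diff D T X (Ys[j := (\<lambda>q. tscale (f q) (Y q))]) p = f p * cov_diff D T X (Ys[j := Y]) p"
    if f: "smooth_fun_on A UNIV f" and Y: "Y \<in> vector_fields A" for f Y
  proof -
    have "(\<Sum>i\<in>{..<k} - {j}. T p ((?v i)[j := tscale (f p) (Y p)])) =
        (\<Sum>i\<in>{..<k} - {j}. f p * T p ((?v i)[j := Y p]))"
      by (intro sum.cong refl) (simp add: tensor_field_scale[OF T v' j] vector_field_tangent Y)
    moreover have "T p ((map (\<lambda>Y. Y p) Ys)[j := D X (\<lambda>q. tscale (f q) (Y q)) p]) =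
        X p f * T p ((map (\<lambda>Y. Y p) Ys)[j := Y p]) + f p * T p ((map (\<lambda>Y. Y p) Ys)[j := D X Y p])"
      by (simp add: connection_scale_right[OF D X Y f] tensor_field_add[OF T len v j]
          tensor_field_scale[OF T len v j] D_tangent X Y tangent_scale vector_field_tangent)
    moreover have "X p (\<lambda>q. T q ((map (\<lambda>Y. Y q) Ys)[j := tscale (f q) (Y q)])) =
        X p f * T p ((map (\<lambda>Y. Y p) Ys)[j := Y p]) + f p * X p (\<lambda>q. T q ((map (\<lambda>Y. Y q) Ys)[j := Y q]))"
      by (simp add: tensor_field_scale[OF T len v j] vector_field_tangent Y
          tangent_fun_mult[OF vector_field_tangent[OF X] smooth_everywhere[OF f] sm])
    ultimately show ?thesis
      by (simp only: cov_diff_update[OF Ys(2) j] sum_distrib_left[symmetric] algebra_simps)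
  qed
qed

lemma cov_diff_pointwise:
  assumes Ys: "set Ys \<subseteq> vector_fields A" "length Ys = k" and X: "X \<in> vector_fields A"
    and Ys': "set Ys' \<subseteq> vector_fields A" and X': "X' \<in> vector_fields A"
    and eq: "X' p = X p" "map (\<lambda>Y. Y p) Ys' = map (\<lambda>Y. Y p) Ys"
  shows "cov_diff D T X' Ys' p = cov_diff D T X Ys p"
proof -
  have len: "length Ys' = k" using eq(2) Ys(2) by (metis length_map)
  \<comment> \<open>The two lists are connected by hybrid lists that differ in one entry at a time,
    so the expansion in a single slot suffices.\<close>
  have "cov_diff D T X (take n Ys' @ drop n Ys) p = cov_diff D T X Ys p" if "n \<le> k" for n
    using that
  proof (induction n)
    case (Suc n)
    let ?Zs = "take n Ys' @ drop n Ys"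
    have n: "n < k" using Suc by simp
    have Zs: "set ?Zs \<subseteq> vector_fields A" "length ?Zs = k"
      using Ys Ys' len set_take_subset[of n Ys'] set_drop_subset[of n Ys] n by auto
    have mem: "Ys ! n \<in> vector_fields A" "Ys' ! n \<in> vector_fields A"
      using Ys Ys' len n nth_mem by (metis subsetD)+
    have "(Ys' ! n) p = (Ys ! n) p"
      using arg_cong[OF eq(2), of "\<lambda>l. l ! n"] n len Ys(2) by simp
    then have "cov_diff D T X (?Zs[n := Ys' ! n]) p = cov_diff D T X (?Zs[n := Ys ! n]) p"
      by (simp only: cov_diff_expand_slot[OF Zs X n mem(1)] cov_diff_expand_slot[OF Zs X n mem(2)])
    moreover have "?Zs[n := Ys ! n] = ?Zs"
      using n len Ys(2) by (simp add: list_update_append Cons_nth_drop_Suc[symmetric])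
    moreover have "?Zs[n := Ys' ! n] = take (Suc n) Ys' @ drop (Suc n) Ys"
      using n len Ys(2)
      by (simp add: list_update_append Cons_nth_drop_Suc[symmetric] take_Suc_conv_app_nth)
    ultimately show ?case using Suc.IH n by simp
  qed simp
  from this[of k] have "cov_diff D T X Ys' p = cov_diff D T X Ys p"
    using len Ys(2) by simp
  moreover have "cov_diff D T X' Ys' p = cov_diff D T X Ys' p"
    by (simp only: cov_diff_expand_left[OF Ys' len X] cov_diff_expand_left[OF Ys' len X'] eq(1))
  ultimately show ?thesis by simp
qed

text \<open>Resolves the \<open>THE\<close>: all extensions give the same number, and the given
  fields are themselves an admissible extension, so no other number qualifies.\<close>

lemma cov_deriv_eq:
  assumes Ys: "set Ys \<subseteq> vector_fields A" "length Ys = k" and X: "X \<in> vector_fields A"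
  shows "cov_deriv A D T p (X p # map (\<lambda>Y. Y p) Ys) = cov_diff D T X Ys p"
  unfolding cov_deriv_def
proof (rule the_equality, intro allI impI)
  fix X' Ys' assume "X' \<in> vector_fields A" "set Ys' \<subseteq> vector_fields A"
    and "map (\<lambda>Y. Y p) (X' # Ys') = X p # map (\<lambda>Y. Y p) Ys"
  then show "cov_diff D T X Ys p = X' p (\<lambda>q. T q (map (\<lambda>Y. Y q) Ys'))
      - (\<Sum>i<length Ys'. T p ((map (\<lambda>Y. Y p) Ys')[i := D X' (Ys' ! i) p]))"
    using cov_diff_pointwise[OF Ys X, of Ys' X' p] by (simp add: cov_diff_def)
next
  fix r assume "\<forall>X' Ys'. X' \<in> vector_fields A \<longrightarrow> set Ys' \<subseteq> vector_fields A \<longrightarrow>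
    map (\<lambda>Y. Y p) (X' # Ys') = X p # map (\<lambda>Y. Y p) Ys \<longrightarrow>
    r = X' p (\<lambda>q. T q (map (\<lambda>Y. Y q) Ys'))
      - (\<Sum>i<length Ys'. T p ((map (\<lambda>Y. Y p) Ys')[i := D X' (Ys' ! i) p]))"
  then show "r = cov_diff D T X Ys p"
    using X Ys(1) by (simp add: cov_diff_def)
qed

lemma cov_deriv_linear_left:
  assumes ws: "set ws \<subseteq> tangent_space A p" "length ws = k"
    and x: "x \<in> tangent_space A p"
  shows "cov_deriv A D T p (x # ws) =
    (\<Sum>a\<in>UNIV. x (\<lambda>q. F q $ a) * cov_deriv A D T p (frame a p # ws))"
proof -
  obtain Ws where Ws: "set Ws \<subseteq> vector_fields A" "map (\<lambda>X. X p) Ws = ws"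
    using vector_fields_through[OF ws(1)] .
  have len: "length Ws = k" using Ws(2) ws(2) by (metis length_map)
  obtain X where X: "X \<in> vector_fields A" "X p = x" using vector_field_through[OF x] .
  have eq: "cov_deriv A D T p (Y p # ws) = cov_diff D T Y Ws p" if "Y \<in> vector_fields A" for Y
    using cov_deriv_eq[OF Ws(1) len that, of p] by (simp only: Ws(2))
  show ?thesis
    using cov_diff_expand_left[OF Ws(1) len X(1), of p] eq[OF X(1)] eq[OF frame_field] X(2)
    by simp
qed

lemma cov_deriv_linear_slot:
  assumes ws: "set ws \<subseteq> tangent_space A p" "length ws = k" and j: "j < k"
    and v: "v \<in> tangent_space A p" and x: "x \<in> tangent_space A p"
  shows "cov_deriv A D T p (v # ws[j := x]) =
    (\<Sum>a\<in>UNIV. x (\<lambda>q. F q $ a) * cov_deriv A D T p (v # ws[j := frame a p]))"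
proof -
  obtain Ws where Ws: "set Ws \<subseteq> vector_fields A" "map (\<lambda>X. X p) Ws = ws"
    using vector_fields_through[OF ws(1)] .
  have len: "length Ws = k" using Ws(2) ws(2) by (metis length_map)
  obtain V where V: "V \<in> vector_fields A" "V p = v" using vector_field_through[OF v] .
  obtain X where X: "X \<in> vector_fields A" "X p = x" using vector_field_through[OF x] .
  have eq: "cov_deriv A D T p (v # ws[j := Y p]) = cov_diff D T V (Ws[j := Y]) p"
    if "Y \<in> vector_fields A" for Y
    using cov_deriv_eq[OF set_update_subset[OF Ws(1) that] _ V(1), of j p] len
    by (simp add: map_update Ws(2) V(2))
  show ?thesis
    using cov_diff_expand_slot[OF Ws(1) len V(1) j X(1), of p] eq[OF X(1)] eq[OF frame_field] X(2)
    by simp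
qed

text \<open>This lets the covariant derivative be iterated. Linearity in every slot follows from one
  frame expansion, because its coefficients are linear in the expanded vector.\<close>

lemma cov_deriv_tensor_field: "tensor_field A (Suc k) (cov_deriv A D T)"
  unfolding tensor_field_def
proof (intro conjI allI impI)
  fix p i x y c and vs :: "'m tvec list"
  assume vs: "length vs = Suc k" "set vs \<subseteq> tangent_space A p" and i: "i < Suc k"
    and x: "x \<in> tangent_space A p" and y: "y \<in> tangent_space A p"
  obtain v ws where v: "vs = v # ws" using vs(1) by (cases vs) auto
  have ws: "set ws \<subseteq> tangent_space A p" "length ws = k" "v \<in> tangent_space A p"
    using vs v by auto
  have expand: "cov_deriv A D T p (vs[i := z]) =
      (\<Sum>a\<in>UNIV. z (\<lambda>q. F q $ a) * cov_deriv A D T p (vs[i := frame a p]))"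
    if "z \<in> tangent_space A p" for z
  proof (cases i)
    case 0
    then show ?thesis using cov_deriv_linear_left[OF ws(1,2) that] by (simp add: v)
  next
    case (Suc j)
    then show ?thesis using cov_deriv_linear_slot[OF ws(1,2) _ ws(3) that] i by (simp add: v)
  qed
  show "cov_deriv A D T p (vs[i := x + y]) =
      cov_deriv A D T p (vs[i := x]) + cov_deriv A D T p (vs[i := y])"
    by (simp add: expand[OF x] expand[OF y] expand[OF tangent_add[OF x y]] distrib_right sum.distrib)
  show "cov_deriv A D T p (vs[i := tscale c x]) = c * cov_deriv A D T p (vs[i := x])"
    unfolding expand[OF x] expand[OF tangent_scale[OF x]]
    by (simp add: tscale_def sum_distrib_left mult.assoc)
next
  fix Ys :: "'m vfield list" assume Ys: "length Ys = Suc k" "set Ys \<subseteq> vector_fields A"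
  obtain X Ws where X: "Ys = X # Ws" using Ys(1) by (cases Ys) auto
  have Ws: "set Ws \<subseteq> vector_fields A" "length Ws = k" "X \<in> vector_fields A" using Ys X by auto
  have "smooth_fun_on A UNIV (\<lambda>q. T q ((map (\<lambda>Y. Y q) Ws)[i := D X (Ws ! i) q]))"
    if "i < k" for i
  proof -
    have "Ws ! i \<in> vector_fields A" using that Ws nth_mem by blast
    then have "smooth_fun_on A UNIV (\<lambda>q. T q (map (\<lambda>Y. Y q) (Ws[i := D X (Ws ! i)])))"
      using Ws by (intro tensor_field_smooth[OF T] set_update_subset connection_field[OF D]) auto
    then show ?thesis by (simp add: map_update)
  qed
  moreover have "smooth_fun_on A UNIV (\<lambda>q. X q (\<lambda>q. T q (map (\<lambda>Y. Y q) Ws)))"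
    by (rule vector_field_smooth[OF Ws(3) open_UNIV tensor_field_smooth[OF T Ws(2,1)]])
  ultimately have "smooth_fun_on A UNIV (\<lambda>q. cov_diff D T X Ws q)"
    unfolding cov_diff_def Ws(2)
    by (intro smooth_fun_on_diff smooth_fun_on_sum open_UNIV) auto
  then show "smooth_fun_on A UNIV (\<lambda>q. cov_deriv A D T q (map (\<lambda>Y. Y q) Ys))"
    by (simp add: X cov_deriv_eq[OF Ws(1,2,3)])
qed

end

end

section \<open>The shape operator and the metric \<open>ghat\<close>\<close>

locale sphere_hypersurface_lc = sphere_hypersurface A F N
  for A :: "('m::{t2_space, second_countable_topology}, 'n::finite) atlas"
    and F N :: "'m \<Rightarrow> real ^ 'k::finite" +
  fixes D0 :: "'m vfield \<Rightarrow> 'm vfield \<Rightarrow> 'm vfield"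
  assumes D0: "levi_civita A (induced_metric F) D0"
begin

subsection \<open>The second fundamental form\<close>

lemmas D0_connection = levi_civita_connection[OF D0]

lemma D0_tangent: "X \<in> vector_fields A \<Longrightarrow> Y \<in> vector_fields A \<Longrightarrow> D0 X Y p \<in> tangent_space A p"
  by (rule vector_field_tangent[OF connection_field[OF D0_connection]])

lemma lie_bracket_apply:
  "smooth_fun_on A UNIV f \<Longrightarrow> lie_bracket A X Y p f = X p (\<lambda>q. Y q f) - Y p (\<lambda>q. X q f)"
  by (simp add: lie_bracket_def smooth_everywhere)

text \<open>The Lie bracket of vector fields is again tangent, since it is the torsion-free
  difference \<open>\<nabla>\<^sub>X Y - \<nabla>\<^sub>Y X\<close>.\<close>

lemma lie_bracket_tangent:
  assumes "X \<in> vector_fields A" "Y \<in> vector_fields A"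
  shows "lie_bracket A X Y p \<in> tangent_space A p"
proof -
  have "(D0 X Y - D0 Y X) p \<in> tangent_space A p"
    using tangent_diff[OF D0_tangent[OF assms] D0_tangent[OF assms(2,1)]] by simp
  then show ?thesis by (simp only: levi_civita_torsion[OF D0 assms])
qed

lemma component_smooth:
  assumes "X \<in> vector_fields A"
  shows "smooth_fun_on A UNIV (\<lambda>q. X q (\<lambda>r. F r $ b))" "smooth_fun_on A UNIV (\<lambda>q. X q (\<lambda>r. N r $ b))"
  by (rule vector_field_smooth[OF assms open_UNIV F_smooth] vector_field_smooth[OF assms open_UNIV N_smooth])+

text \<open>Up to sign the two sides are <N, Y(dF X)> and <N, X(dF Y)>. They differ by the pairing
  of \<open>N\<close> with dF of the bracket, which vanishes since the bracket is tangent.\<close>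

lemma second_form_symmetric:
  assumes x: "x \<in> tangent_space A p" and y: "y \<in> tangent_space A p"
  shows "(\<Sum>b\<in>UNIV. x (\<lambda>q. F q $ b) * y (\<lambda>q. N q $ b)) =
    (\<Sum>b\<in>UNIV. x (\<lambda>q. N q $ b) * y (\<lambda>q. F q $ b))"
proof -
  obtain X where X: "X \<in> vector_fields A" "X p = x" using vector_field_through[OF x] .
  obtain Y where Y: "Y \<in> vector_fields A" "Y p = y" using vector_field_through[OF y] .
  \<comment> \<open>Differentiate <N, dF V> = 0 along u.\<close>
  have *: "(\<Sum>b\<in>UNIV. N p $ b * u (\<lambda>q. V q (\<lambda>r. F r $ b))) =
      - (\<Sum>b\<in>UNIV. u (\<lambda>q. N q $ b) * V p (\<lambda>r. F r $ b))"
    if "u \<in> tangent_space A p" "V \<in> vector_fields A" for u V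
    using tangent_sum_mult[OF that(1), of "\<lambda>b q. N q $ b" "\<lambda>b q. V q (\<lambda>r. F r $ b)",
        OF N_smooth component_smooth(1)[OF that(2)]]
      N_dF[OF vector_field_tangent[OF that(2)]] tangent_fun_const[OF that(1), of 0] by simp
  have "0 = (\<Sum>b\<in>UNIV. N p $ b * lie_bracket A X Y p (\<lambda>q. F q $ b))"
    using N_dF[OF lie_bracket_tangent[OF X(1) Y(1)]] by simp
  also have "\<dots> = (\<Sum>b\<in>UNIV. N p $ b * x (\<lambda>q. Y q (\<lambda>r. F r $ b)))
      - (\<Sum>b\<in>UNIV. N p $ b * y (\<lambda>q. X q (\<lambda>r. F r $ b)))"
    by (simp add: lie_bracket_apply[OF F_smooth] X(2) Y(2) right_diff_distrib sum_subtractf)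
  finally show ?thesis
    using *[OF x Y(1)] *[OF y X(1)] by (simp add: X(2) Y(2) mult.commute)
qed

abbreviation shape :: "'m \<Rightarrow> 'm tvec \<Rightarrow> 'm tvec"
  where "shape \<equiv> shape_operator A F N"

text \<open>dN x is orthogonal to both \<open>F\<close> and \<open>N\<close>, so its negative is dF
  of a unique tangent vector, which resolves the \<open>THE\<close>. The frame formula also shows
  that smooth fields go to smooth fields.\<close>

lemma shape_eq:
  assumes x: "x \<in> tangent_space A p"
  shows "shape p x = (\<lambda>f. \<Sum>a\<in>UNIV. - x (\<lambda>q. N q $ a) * frame a p f)"
    and "shape p x \<in> tangent_space A p"
    and "shape p x (\<lambda>q. F q $ b) = - x (\<lambda>q. N q $ b)"
proof -
  let ?w = "\<lambda>f. \<Sum>a\<in>UNIV. - x (\<lambda>q. N q $ a) * frame a p f"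
  have w: "?w \<in> tangent_space A p" by (rule tangent_lincomb[OF finite frame_tangent])
  have wF: "?w (\<lambda>q. F q $ b) = - x (\<lambda>q. N q $ b)" for b
    by (rule sum_frame_F(1)) (simp_all add: sum_negf F_dN[OF x] N_dN[OF x])
  have "shape p x = ?w"
    unfolding shape_operator_def
  proof (rule the_equality)
    show "?w \<in> tangent_space A p \<and> vdiff N x = - vdiff F ?w"
      using w wF by (simp add: vdiff_def vec_eq_iff)
    fix w' assume w': "w' \<in> tangent_space A p \<and> vdiff N x = - vdiff F w'"
    show "w' = ?w"
    proof (rule tangent_eqI[OF _ w])
      show "w' (\<lambda>q. F q $ b) = ?w (\<lambda>q. F q $ b)" for b
        unfolding wF using w' by (simp add: vdiff_def vec_eq_iff)
    qed (use w' in simp)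
  qed
  then show "shape p x = ?w" "shape p x \<in> tangent_space A p"
    "shape p x (\<lambda>q. F q $ b) = - x (\<lambda>q. N q $ b)"
    using w wF by (simp_all only:)
qed

lemma shape_field:
  assumes Y: "Y \<in> vector_fields A"
  shows "(\<lambda>q. shape q (Y q)) \<in> vector_fields A"
  unfolding shape_eq(1)[OF vector_field_tangent[OF Y]]
  by (rule vector_field_lincomb[OF frame_field smooth_fun_on_uminus[OF open_UNIV component_smooth(2)[OF Y]]
        finite])

lemma tangent_eqI_inner:
  assumes x: "x \<in> tangent_space A p" and y: "y \<in> tangent_space A p"
    and eq: "\<And>z. z \<in> tangent_space A p \<Longrightarrow>
      (\<Sum>b\<in>UNIV. x (\<lambda>q. F q $ b) * z (\<lambda>q. F q $ b)) = (\<Sum>b\<in>UNIV. y (\<lambda>q. F q $ b) * z (\<lambda>q. F q $ b))"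
  shows "x = y"
proof (rule tangent_eqI[OF x y])
  fix a
  have "(\<Sum>b\<in>UNIV. ((x - y) (\<lambda>q. F q $ b))\<^sup>2) = 0"
    using eq[OF tangent_diff[OF x y]]
    by (simp add: power2_eq_square left_diff_distrib sum_subtractf)
  then show "x (\<lambda>q. F q $ a) = y (\<lambda>q. F q $ a)"
    by (simp add: sum_nonneg_eq_0_iff)
qed

text \<open>The Levi-Civita connection of the induced metric is the tangential part of the derivative
  in the ambient space.\<close>

lemma D0_inner:
  assumes X: "X \<in> vector_fields A" and Y: "Y \<in> vector_fields A" and z: "z \<in> tangent_space A p"
  shows "(\<Sum>b\<in>UNIV. D0 X Y p (\<lambda>q. F q $ b) * z (\<lambda>q. F q $ b)) =
    (\<Sum>b\<in>UNIV. X p (\<lambda>q. Y q (\<lambda>r. F r $ b)) * z (\<lambda>q. F q $ b))"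
proof -
  let ?B = "\<lambda>X Y Z. \<Sum>b\<in>UNIV. (D0 X Y p (\<lambda>q. F q $ b) - X p (\<lambda>q. Y q (\<lambda>r. F r $ b))) * Z p (\<lambda>q. F q $ b)"
  obtain Z where Z: "Z \<in> vector_fields A" "Z p = z" using vector_field_through[OF z] .
  \<comment> \<open>Paired with tangent vectors, the ambient derivative obeys the same torsion and
    metric laws as \<open>D0\<close>, so their difference is symmetric and skew as the algebraic
    lemma demands.\<close>
  have "?B X Y Z = 0"
  proof (rule symmetric_skew_eq_0[of "vector_fields A" ?B, OF _ _ X Y Z(1)])
    fix X Y Z
    assume X: "X \<in> vector_fields A" and Y: "Y \<in> vector_fields A" and Z: "Z \<in> vector_fields A"
    have *: "D0 X Y p (\<lambda>q. F q $ b) - D0 Y X p (\<lambda>q. F q $ b) =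
        X p (\<lambda>q. Y q (\<lambda>r. F r $ b)) - Y p (\<lambda>q. X q (\<lambda>r. F r $ b))" for b
      using fun_cong[OF fun_cong[OF levi_civita_torsion[OF D0 X Y], of p], of "\<lambda>q. F q $ b"]
      by (simp add: lie_bracket_apply[OF F_smooth])
    have "D0 X Y p (\<lambda>q. F q $ b) - X p (\<lambda>q. Y q (\<lambda>r. F r $ b)) =
        D0 Y X p (\<lambda>q. F q $ b) - Y p (\<lambda>q. X q (\<lambda>r. F r $ b))" for b
      using *[of b] by linarith
    then show "?B X Y Z = ?B Y X Z" by simp
    have "X p (\<lambda>q. \<Sum>b\<in>UNIV. Y q (\<lambda>r. F r $ b) * Z q (\<lambda>r. F r $ b)) =
        (\<Sum>b\<in>UNIV. X p (\<lambda>q. Y q (\<lambda>r. F r $ b)) * Z p (\<lambda>r. F r $ b)) +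
        (\<Sum>b\<in>UNIV. Y p (\<lambda>r. F r $ b) * X p (\<lambda>q. Z q (\<lambda>r. F r $ b)))"
      using tangent_sum_mult[OF vector_field_tangent[OF X], of "\<lambda>b q. Y q (\<lambda>r. F r $ b)"
          "\<lambda>b q. Z q (\<lambda>r. F r $ b)", OF component_smooth(1)[OF Y] component_smooth(1)[OF Z]] .
    with levi_civita_metric[OF D0 X Y Z, of p]
    show "?B X Y Z = - ?B X Z Y"
      by (simp add: induced_metric_def vdiff_inner right_diff_distrib sum_subtractf mult.commute)
  qed
  then show ?thesis by (simp add: Z(2) left_diff_distrib sum_subtractf)
qed

subsection \<open>The covariant derivative of the shape operator\<close>

text \<open>\<open>\<langle>X(dF Y), dN z\<rangle> - \<langle>X(dN Y), dF z\<rangle>\<close>, written with the components of \<open>F\<close> and \<open>N\<close>.\<close>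

definition cubic_form :: "'m vfield \<Rightarrow> 'm vfield \<Rightarrow> 'm \<Rightarrow> 'm tvec \<Rightarrow> real"
  where "cubic_form X Y p z =
    (\<Sum>b\<in>UNIV. X p (\<lambda>q. Y q (\<lambda>r. F r $ b)) * z (\<lambda>q. N q $ b))
    - (\<Sum>b\<in>UNIV. X p (\<lambda>q. Y q (\<lambda>r. N r $ b)) * z (\<lambda>q. F q $ b))"

text \<open>In the ambient space AY is -dN Y, which yields the second term. For the first, A is
  moved to z by symmetry; as Az = -dN z is tangent, \<open>D0\<close> may be replaced by the ambient
  derivative.\<close>

lemma cov_shape_inner:
  assumes X: "X \<in> vector_fields A" and Y: "Y \<in> vector_fields A" and z: "z \<in> tangent_space A p"
  shows "(\<Sum>b\<in>UNIV. (D0 X (\<lambda>q. shape q (Y q)) p - shape p (D0 X Y p)) (\<lambda>q. F q $ b) *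
    z (\<lambda>q. F q $ b)) = cubic_form X Y p z"
proof -
  note Yt = vector_field_tangent[OF Y] and V = D0_tangent[OF X Y, of p]
  have "X p (\<lambda>q. - Y q (\<lambda>r. N r $ b)) = - X p (\<lambda>q. Y q (\<lambda>r. N r $ b))" for b
    by (rule tangent_fun_uminus[OF vector_field_tangent[OF X]
          smooth_everywhere[OF component_smooth(2)[OF Y]]])
  then have 1: "(\<Sum>b\<in>UNIV. D0 X (\<lambda>q. shape q (Y q)) p (\<lambda>q. F q $ b) * z (\<lambda>q. F q $ b)) =
      - (\<Sum>b\<in>UNIV. X p (\<lambda>q. Y q (\<lambda>r. N r $ b)) * z (\<lambda>q. F q $ b))"
    unfolding D0_inner[OF X shape_field[OF Y] z] by (simp add: shape_eq(3)[OF Yt] sum_negf)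
  have "(\<Sum>b\<in>UNIV. shape p (D0 X Y p) (\<lambda>q. F q $ b) * z (\<lambda>q. F q $ b)) =
      (\<Sum>b\<in>UNIV. D0 X Y p (\<lambda>q. F q $ b) * shape p z (\<lambda>q. F q $ b))"
    by (simp add: shape_eq(3)[OF V] shape_eq(3)[OF z] sum_negf second_form_symmetric[OF V z])
  also have "\<dots> = - (\<Sum>b\<in>UNIV. X p (\<lambda>q. Y q (\<lambda>r. F r $ b)) * z (\<lambda>q. N q $ b))"
    unfolding D0_inner[OF X Y shape_eq(2)[OF z]] by (simp add: shape_eq(3)[OF z] sum_negf)
  finally show ?thesis
    using 1 by (simp add: cubic_form_def left_diff_distrib sum_subtractf)
qed

text \<open>Each half fails to be linear over functions in Y. The surplus is X(f) times <dF Y, dN z>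
  - <dN Y, dF z>, which is zero by symmetry of the second fundamental form.\<close>

lemma cubic_form_expand:
  assumes X: "X \<in> vector_fields A" and Y: "Y \<in> vector_fields A" and z: "z \<in> tangent_space A p"
  shows "cubic_form X Y p z = (\<Sum>a\<in>UNIV. Y p (\<lambda>q. F q $ a) * cubic_form X (frame a) p z)"
proof (rule tensorial_expansion[OF _ _ Y])
  note Xp = vector_field_tangent[OF X, of p]
  show "cubic_form X (Y + Y') p z = cubic_form X Y p z + cubic_form X Y' p z"
    if "Y \<in> vector_fields A" "Y' \<in> vector_fields A" for Y Y'
    by (simp add: cubic_form_def distrib_right sum.distrib
        tangent_fun_add[OF Xp smooth_everywhere smooth_everywhere] component_smooth that)
  show "cubic_form X (\<lambda>q. tscale (f q) (Y q)) p z = f p * cubic_form X Y p z"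
    if f: "smooth_fun_on A UNIV f" and Y: "Y \<in> vector_fields A" for f Y
  proof -
    have "cubic_form X (\<lambda>q. tscale (f q) (Y q)) p z =
        X p f * (\<Sum>b\<in>UNIV. Y p (\<lambda>q. F q $ b) * z (\<lambda>q. N q $ b))
        - X p f * (\<Sum>b\<in>UNIV. Y p (\<lambda>q. N q $ b) * z (\<lambda>q. F q $ b)) + f p * cubic_form X Y p z"
      by (simp add: cubic_form_def tscale_def component_smooth[OF Y]
          tangent_fun_mult[OF Xp smooth_everywhere[OF f] smooth_everywhere]
          distrib_right sum.distrib sum_distrib_left right_diff_distrib mult.assoc)
    then show ?thesis
      using second_form_symmetric[OF vector_field_tangent[OF Y] z] by simp
  qed
qed

lemma cubic_form_pointwise:
  assumes "X \<in> vector_fields A" "Y \<in> vector_fields A" "X' \<in> vector_fields A" "Y' \<in> vector_fields A"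
    and "z \<in> tangent_space A p" "X' p = X p" "Y' p = Y p"
  shows "cubic_form X' Y' p z = cubic_form X Y p z"
  using assms(6,7)
  unfolding cubic_form_expand[OF assms(1,2,5)] cubic_form_expand[OF assms(3,4,5)]
  by (simp add: cubic_form_def)

section \<open>The tensor field \<alpha>\<close>

abbreviation alpha0 :: "'m tensor"
  where "alpha0 \<equiv> alpha A F N D0"

text \<open>A tangent vector is determined by its inner products with tangent vectors. Those of
  (\<nabla>A)Y depend only on the values of the fields at p, so the \<open>THE\<close> in
  \<open>cov_deriv_endo\<close> is resolved.\<close>

lemma alpha_eq:
  assumes X: "X \<in> vector_fields A" and Y: "Y \<in> vector_fields A" and z: "z \<in> tangent_space A p"
  shows "alpha0 p [X p, Y p, z] = cubic_form X Y p z"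
proof -
  let ?w = "\<lambda>X Y. D0 X (\<lambda>q. shape q (Y q)) p - shape p (D0 X Y p)"
  have wt: "?w X Y \<in> tangent_space A p" if "X \<in> vector_fields A" "Y \<in> vector_fields A" for X Y
    by (intro tangent_diff D0_tangent shape_eq(2) shape_field that)
  have "cov_deriv_endo A D0 shape p (X p) (Y p) = ?w X Y"
    unfolding cov_deriv_endo_def
  proof (rule the_equality, intro ballI impI)
    fix X' Y' assume X': "X' \<in> vector_fields A" and Y': "Y' \<in> vector_fields A"
      and eq: "X' p = X p" "Y' p = Y p"
    show "?w X Y = ?w X' Y'"
      by (rule tangent_eqI_inner[OF wt[OF X Y] wt[OF X' Y']])
        (simp only: cov_shape_inner[OF X Y] cov_shape_inner[OF X' Y'] cubic_form_pointwise[OF X Y X' Y' _ eq])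
  qed (use X Y in blast)
  then show ?thesis
    using cov_shape_inner[OF X Y z] by (simp add: alpha_def induced_metric_def vdiff_inner)
qed

lemma cubic_form_smooth:
  assumes "X \<in> vector_fields A" "Y \<in> vector_fields A" "Z \<in> vector_fields A"
  shows "smooth_fun_on A UNIV (\<lambda>p. cubic_form X Y p (Z p))"
  unfolding cubic_form_def
  by (intro smooth_fun_on_diff smooth_fun_on_sum smooth_fun_on_mult open_UNIV component_smooth
      vector_field_smooth[OF assms(1)] assms)

text \<open>The slots are linear for different reasons: the first because X acts only as a
  derivation at p, the second by the cancellation in \<open>cubic_form_expand\<close>, the third
  because z enters linearly.\<close>

lemma alpha_tensor_field: "tensor_field A 3 alpha0"
  unfolding tensor_field_def
proof (intro conjI allI impI)
  fix p x y c and i :: nat and vs :: "'m tvec list"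
  assume vs: "length vs = 3" "set vs \<subseteq> tangent_space A p" and i: "i < 3"
    and x: "x \<in> tangent_space A p" and y: "y \<in> tangent_space A p"
  obtain v1 v2 v3 where v: "vs = [v1, v2, v3]"
    using vs(1) by (auto simp: numeral_3_eq_3 length_Suc_conv)
  have vt: "v1 \<in> tangent_space A p" "v2 \<in> tangent_space A p" "v3 \<in> tangent_space A p"
    using vs(2) v by auto
  obtain V1 where V1: "V1 \<in> vector_fields A" "V1 p = v1" using vector_field_through[OF vt(1)] .
  obtain V2 where V2: "V2 \<in> vector_fields A" "V2 p = v2" using vector_field_through[OF vt(2)] .
  have expand: "alpha0 p (vs[i := z]) =
      (\<Sum>a\<in>UNIV. z (\<lambda>q. F q $ a) * alpha0 p (vs[i := frame a p]))"
    if z: "z \<in> tangent_space A p" for z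
  proof -
    consider "i = 0" | "i = 1" | "i = 2" using i by linarith
    then show ?thesis
    proof cases
      case 1
      obtain Z where Z: "Z \<in> vector_fields A" "Z p = z" using vector_field_through[OF z] .
      have "cubic_form Z V2 p v3 = (\<Sum>a\<in>UNIV. z (\<lambda>q. F q $ a) * cubic_form (frame a) V2 p v3)"
        unfolding Z(2)[symmetric]
      proof (rule tensorial_expansion[OF _ _ Z(1)])
        show "cubic_form (X + Y) V2 p v3 = cubic_form X V2 p v3 + cubic_form Y V2 p v3" for X Y
          by (simp add: cubic_form_def distrib_right sum.distrib)
        show "cubic_form (\<lambda>q. tscale (f q) (X q)) V2 p v3 = f p * cubic_form X V2 p v3" for f X
          by (simp add: cubic_form_def tscale_def right_diff_distrib sum_distrib_left mult.assoc)
      qed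
      then show ?thesis
        using alpha_eq[OF Z(1) V2(1) vt(3)] alpha_eq[OF frame_field V2(1) vt(3)] Z(2) V2(2)
        by (simp add: 1 v)
    next
      case 2
      obtain Z where Z: "Z \<in> vector_fields A" "Z p = z" using vector_field_through[OF z] .
      show ?thesis
        using alpha_eq[OF V1(1) Z(1) vt(3)] alpha_eq[OF V1(1) frame_field vt(3)] Z(2) V1(2)
          cubic_form_expand[OF V1(1) Z(1) vt(3)]
        by (simp add: 2 v)
    next
      case 3
      have al: "alpha0 p [v1, v2, u] = cubic_form V1 V2 p u" if "u \<in> tangent_space A p" for u
        using alpha_eq[OF V1(1) V2(1) that] V1(2) V2(2) by simp
      have "cubic_form V1 V2 p z = (\<Sum>a\<in>UNIV. z (\<lambda>q. F q $ a) * cubic_form V1 V2 p (frame a p))"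
      proof -
        let ?P = "\<lambda>b. V1 p (\<lambda>q. V2 q (\<lambda>r. F r $ b))" and ?Q = "\<lambda>b. V1 p (\<lambda>q. V2 q (\<lambda>r. N r $ b))"
        let ?l = "\<lambda>u :: 'm tvec. \<Sum>b\<in>UNIV. ?P b * u (\<lambda>q. N q $ b) - ?Q b * u (\<lambda>q. F q $ b)"
        have "z f = (\<Sum>a\<in>UNIV. z (\<lambda>q. F q $ a) * frame a p f)" for f
          using fun_cong[OF frame_expansion[OF z]] .
        then have "?l z = (\<Sum>b\<in>UNIV. ?P b * (\<Sum>a\<in>UNIV. z (\<lambda>q. F q $ a) * frame a p (\<lambda>q. N q $ b))
            - ?Q b * (\<Sum>a\<in>UNIV. z (\<lambda>q. F q $ a) * frame a p (\<lambda>q. F q $ b)))"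
          by metis
        also have "\<dots> = (\<Sum>b\<in>UNIV. \<Sum>a\<in>UNIV. z (\<lambda>q. F q $ a) *
            (?P b * frame a p (\<lambda>q. N q $ b) - ?Q b * frame a p (\<lambda>q. F q $ b)))"
          by (simp add: sum_distrib_left sum_subtractf right_diff_distrib mult_ac)
        also have "\<dots> = (\<Sum>a\<in>UNIV. z (\<lambda>q. F q $ a) * ?l (frame a p))"
          unfolding sum_distrib_left by (rule sum.swap)
        finally show ?thesis by (simp add: cubic_form_def sum_subtractf)
      qed
      then show ?thesis
        using al[OF z] al[OF frame_tangent] by (simp add: 3 v numeral_2_eq_2)
    qed
  qed
  show "alpha0 p (vs[i := x + y]) = alpha0 p (vs[i := x]) + alpha0 p (vs[i := y])"
    unfolding expand[OF x] expand[OF y] expand[OF tangent_add[OF x y]]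
    by (simp add: distrib_right sum.distrib)
  show "alpha0 p (vs[i := tscale c x]) = c * alpha0 p (vs[i := x])"
    unfolding expand[OF x] expand[OF tangent_scale[OF x]]
    by (simp add: tscale_def sum_distrib_left mult.assoc)
next
  fix Ys :: "'m vfield list" assume Ys: "length Ys = 3" "set Ys \<subseteq> vector_fields A"
  obtain X Y Z where v: "Ys = [X, Y, Z]"
    using Ys(1) by (auto simp: numeral_3_eq_3 length_Suc_conv)
  then have XYZ: "X \<in> vector_fields A" "Y \<in> vector_fields A" "Z \<in> vector_fields A"
    using Ys(2) by auto
  show "smooth_fun_on A UNIV (\<lambda>q. alpha0 q (map (\<lambda>Y. Y q) Ys))"
    using cubic_form_smooth[OF XYZ]
    by (simp add: v alpha_eq[OF XYZ(1,2) vector_field_tangent[OF XYZ(3)]])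
qed

section \<open>The metric \<open>ghat\<close>\<close>

abbreviation ghat0 :: "'m \<Rightarrow> 'm tvec \<Rightarrow> 'm tvec \<Rightarrow> real"
  where "ghat0 \<equiv> ghat A F N"

text \<open>Symmetry of A turns <x, A^2 y> into <Ax, Ay> = <dN x, dN y>. Now \<open>F\<close> and
  \<open>N\<close> enter on an equal footing, which is what an orthogonal change of the pair
  preserves.\<close>

lemma ghat_eq:
  assumes x: "x \<in> tangent_space A p" and y: "y \<in> tangent_space A p"
  shows "ghat0 p x y = (\<Sum>b\<in>UNIV. x (\<lambda>q. F q $ b) * y (\<lambda>q. F q $ b) +
    x (\<lambda>q. N q $ b) * y (\<lambda>q. N q $ b)) / 2"
proof -
  note Sy = shape_eq(2)[OF y]
  have "ghat0 p x y = (\<Sum>b\<in>UNIV. x (\<lambda>q. F q $ b) * y (\<lambda>q. F q $ b)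
      - x (\<lambda>q. F q $ b) * shape p y (\<lambda>q. N q $ b)) / 2"
    by (simp add: ghat_def induced_metric_def vdiff_inner tscale_def shape_eq(3)[OF Sy]
        sum_divide_distrib right_diff_distrib)
  also have "\<dots> = ((\<Sum>b\<in>UNIV. x (\<lambda>q. F q $ b) * y (\<lambda>q. F q $ b))
      - (\<Sum>b\<in>UNIV. x (\<lambda>q. N q $ b) * shape p y (\<lambda>q. F q $ b))) / 2"
    by (simp add: sum_subtractf second_form_symmetric[OF x Sy])
  finally show ?thesis by (simp add: shape_eq(3)[OF y] sum_negf sum.distrib)
qed

lemma ghat_smooth:
  assumes X: "X \<in> vector_fields A" and Y: "Y \<in> vector_fields A"
  shows "smooth_fun_on A UNIV (\<lambda>q. ghat0 q (X q) (Y q))"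
proof -
  have "smooth_fun_on A UNIV (\<lambda>q. (\<Sum>b\<in>UNIV. X q (\<lambda>q. F q $ b) * Y q (\<lambda>q. F q $ b) +
      X q (\<lambda>q. N q $ b) * Y q (\<lambda>q. N q $ b)) * (1 / 2))"
    by (intro smooth_fun_on_mult smooth_fun_on_sum smooth_fun_on_add smooth_fun_on_const open_UNIV
        component_smooth X Y)
  then show ?thesis
    by (simp add: ghat_eq[OF vector_field_tangent[OF X] vector_field_tangent[OF Y]])
qed

lemma ghat_commute:
  "x \<in> tangent_space A p \<Longrightarrow> y \<in> tangent_space A p \<Longrightarrow> ghat0 p x y = ghat0 p y x"
  by (simp add: ghat_eq mult.commute)

lemma ghat_diff_left:
  assumes "x \<in> tangent_space A p" "y \<in> tangent_space A p" "z \<in> tangent_space A p"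
  shows "ghat0 p (x - y) z = ghat0 p x z - ghat0 p y z"
  unfolding ghat_eq[OF tangent_diff[OF assms(1,2)] assms(3)] ghat_eq[OF assms(1,3)]
    ghat_eq[OF assms(2,3)] minus_apply left_diff_distrib sum.distrib sum_subtractf
  by argo

lemma ghat_eqI:
  assumes x: "x \<in> tangent_space A p" and y: "y \<in> tangent_space A p"
    and eq: "\<And>z. z \<in> tangent_space A p \<Longrightarrow> ghat0 p x z = ghat0 p y z"
  shows "x = y"
proof (rule tangent_eqI[OF x y])
  fix a
  note d = tangent_diff[OF x y]
  have "ghat0 p (x - y) (x - y) = 0"
    using eq[OF d] by (simp add: ghat_diff_left[OF x y d])
  then have "(\<Sum>b\<in>UNIV. ((x - y) (\<lambda>q. F q $ b))\<^sup>2 + ((x - y) (\<lambda>q. N q $ b))\<^sup>2) = 0"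
    by (simp add: ghat_eq[OF d d] power2_eq_square del: minus_apply)
  then show "x (\<lambda>q. F q $ a) = y (\<lambda>q. F q $ a)"
    by (simp add: sum_nonneg_eq_0_iff add_nonneg_eq_0_iff)
qed

end

section \<open>Reflections in the focal submanifolds\<close>

text \<open>Keeping c and s as numbers on the unit circle turns the computations into polynomial
  identities. For c = cos 2\<theta> and s = sin 2\<theta> the matrix is the reflection in the line
  at angle \<theta>.\<close>

locale sphere_reflection = sphere_hypersurface_lc A F N D0
  for A :: "('m::{t2_space, second_countable_topology}, 'n::finite) atlas"
    and F N :: "'m \<Rightarrow> real ^ 'k::finite" and D0 +
  fixes D :: "'m vfield \<Rightarrow> 'm vfield \<Rightarrow> 'm vfield" and \<tau> :: "'m \<Rightarrow> 'm" and c s :: real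
  assumes D: "levi_civita A (ghat A F N) D"
    and smooth: "smooth_self_map A \<tau>"
    and norm_1: "c\<^sup>2 + s\<^sup>2 = 1"
    and F_reflect: "F (\<tau> p) = c *\<^sub>R F p + s *\<^sub>R N p"
    and N_reflect: "N (\<tau> p) = s *\<^sub>R F p - c *\<^sub>R N p"
begin

lemmas D_connection = levi_civita_connection[OF D]

lemma norm_1': "c * c + s * s = 1"
  using norm_1 by (simp add: power2_eq_square)

text \<open>The reflection matrix squares to the identity, so \<open>F\<close> takes the same value
  at both points, and \<open>F\<close> is injective as a homeomorphism onto its image.\<close>

lemma involution [simp]: "\<tau> (\<tau> p) = p"
proof -
  have "F (\<tau> (\<tau> p)) = (c * c + s * s) *\<^sub>R F p"
    by (simp add: F_reflect N_reflect algebra_simps)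
  then have eq: "F (\<tau> (\<tau> p)) = F p" by (simp add: norm_1')
  obtain G where "homeomorphism UNIV (range F) F G"
    using embedding unfolding sphere_embedding_def by blast
  then have "G (F q) = q" for q by (simp add: homeomorphism_def)
  then show ?thesis using eq by metis
qed

lemma inv_reflection: "inv \<tau> = \<tau>"
  by (rule inv_equality) simp_all

abbreviation d\<tau> :: "'m \<Rightarrow> 'm tvec \<Rightarrow> 'm tvec"
  where "d\<tau> \<equiv> differential A \<tau>"

lemma d\<tau>_tangent: "x \<in> tangent_space A p \<Longrightarrow> d\<tau> p x \<in> tangent_space A (\<tau> p)"
  by (rule differential_tangent[OF smooth])

lemma d\<tau>_apply: "smooth_fun_on A UNIV f \<Longrightarrow> d\<tau> p x f = x (\<lambda>q. f (\<tau> q))"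
  by (simp add: differential_def smooth_everywhere o_def)

lemma d\<tau>_F:
  assumes x: "x \<in> tangent_space A p"
  shows "d\<tau> p x (\<lambda>q. F q $ b) = c * x (\<lambda>q. F q $ b) + s * x (\<lambda>q. N q $ b)"
proof -
  have sm: "smooth_fun_on A UNIV (\<lambda>q. r * F q $ b)" "smooth_fun_on A UNIV (\<lambda>q. r * N q $ b)" for r
    by (intro smooth_fun_on_mult smooth_fun_on_const open_UNIV F_smooth N_smooth)+
  have "d\<tau> p x (\<lambda>q. F q $ b) = x (\<lambda>q. c * F q $ b + s * N q $ b)"
    by (simp add: d\<tau>_apply[OF F_smooth] F_reflect)
  then show ?thesis
    by (simp add: tangent_fun_add[OF x smooth_everywhere smooth_everywhere] sm
        tangent_fun_cmult[OF x smooth_everywhere] F_smooth N_smooth)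
qed

lemma d\<tau>_N:
  assumes x: "x \<in> tangent_space A p"
  shows "d\<tau> p x (\<lambda>q. N q $ b) = s * x (\<lambda>q. F q $ b) - c * x (\<lambda>q. N q $ b)"
proof -
  have sm: "smooth_fun_on A UNIV (\<lambda>q. r * F q $ b)" "smooth_fun_on A UNIV (\<lambda>q. r * N q $ b)" for r
    by (intro smooth_fun_on_mult smooth_fun_on_const open_UNIV F_smooth N_smooth)+
  have "d\<tau> p x (\<lambda>q. N q $ b) = x (\<lambda>q. s * F q $ b + (- c) * N q $ b)"
    by (simp add: d\<tau>_apply[OF N_smooth] N_reflect)
  also have "\<dots> = s * x (\<lambda>q. F q $ b) + (- c) * x (\<lambda>q. N q $ b)"
    unfolding tangent_fun_add[OF x smooth_everywhere[OF sm(1)] smooth_everywhere[OF sm(2)]]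
      tangent_fun_cmult[OF x smooth_everywhere[OF F_smooth]]
      tangent_fun_cmult[OF x smooth_everywhere[OF N_smooth]] ..
  finally show ?thesis by simp
qed

lemma d\<tau>_involution:
  assumes x: "x \<in> tangent_space A p"
  shows "d\<tau> (\<tau> p) (d\<tau> p x) = x"
proof (rule tangent_eqI)
  show "d\<tau> (\<tau> p) (d\<tau> p x) \<in> tangent_space A p"
    using d\<tau>_tangent[OF d\<tau>_tangent[OF x]] by simp
  fix b
  have "d\<tau> (\<tau> p) (d\<tau> p x) (\<lambda>q. F q $ b) = (c * c + s * s) * x (\<lambda>q. F q $ b)"
    by (simp add: d\<tau>_F[OF d\<tau>_tangent[OF x]] d\<tau>_F[OF x] d\<tau>_N[OF x] algebra_simps)
  then show "d\<tau> (\<tau> p) (d\<tau> p x) (\<lambda>q. F q $ b) = x (\<lambda>q. F q $ b)" by (simp add: norm_1')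
qed fact

text \<open>The push-forward of a vector field under \<tau>; the inverse that would normally appear
  is \<tau> itself.\<close>

definition push :: "'m vfield \<Rightarrow> 'm vfield"
  where "push X q = d\<tau> (\<tau> q) (X (\<tau> q))"

lemma push_apply: "push X (\<tau> p) = d\<tau> p (X p)"
  by (simp add: push_def)

lemma smooth_reflect:
  fixes f :: "'m \<Rightarrow> real"
  shows "smooth_fun_on A UNIV f \<Longrightarrow> smooth_fun_on A UNIV (\<lambda>q. f (\<tau> q))"
  using smooth_fun_on_comp_self_map[OF smooth open_UNIV] by (simp add: o_def)

lemma push_field:
  assumes X: "X \<in> vector_fields A"
  shows "push X \<in> vector_fields A"
proof (rule vector_fieldI)
  show "push X p \<in> tangent_space A p" for p
    using d\<tau>_tangent[OF vector_field_tangent[OF X], of "\<tau> p"] by (simp add: push_def)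
next
  fix W and f :: "'m \<Rightarrow> real" assume W: "open W" "smooth_fun_on A W f"
  let ?V = "\<tau> -` W"
  have V: "open ?V" by (rule smooth_self_map_open_preimage[OF smooth W(1)])
  \<comment> \<open>Pull f back by \<tau>, differentiate along X, pull back once more; the double
    preimage of W is W.\<close>
  have "smooth_fun_on A (\<tau> -` ?V) ((\<lambda>q. X q (f \<circ> \<tau>)) \<circ> \<tau>)"
    by (intro smooth_fun_on_comp_self_map[OF smooth V] vector_field_smooth[OF X V]
        smooth_fun_on_comp_self_map[OF smooth W])
  moreover have "\<tau> -` ?V = W" by auto
  ultimately have "smooth_fun_on A W (\<lambda>q. X (\<tau> q) (f \<circ> \<tau>))" by (simp add: o_def)
  then show "smooth_fun_on A W (\<lambda>q. push X q f)"
    by (rule smooth_fun_on_cong[OF W(1), rotated])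
      (simp add: push_def differential_def smooth_atI[OF W(2,1)])
qed

lemma push_derivative: "smooth_fun_on A UNIV f \<Longrightarrow> push X (\<tau> p) f = X p (\<lambda>q. f (\<tau> q))"
  by (simp add: push_apply d\<tau>_apply)

lemma cubic_form_reflect:
  assumes X: "X \<in> vector_fields A" and Y: "Y \<in> vector_fields A" and z: "z \<in> tangent_space A p"
  shows "cubic_form (push X) (push Y) (\<tau> p) (d\<tau> p z) = - cubic_form X Y p z"
proof -
  note Xp = vector_field_tangent[OF X, of p] and Yq = vector_field_tangent[OF Y]
  let ?P = "\<lambda>b. X p (\<lambda>q. Y q (\<lambda>r. F r $ b))" and ?Q = "\<lambda>b. X p (\<lambda>q. Y q (\<lambda>r. N r $ b))"
  have sm: "smooth_at A p (\<lambda>q. t * Y q (\<lambda>r. F r $ b))" "smooth_at A p (\<lambda>q. t * Y q (\<lambda>r. N r $ b))"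
    for b t
    by (intro smooth_everywhere smooth_fun_on_mult smooth_fun_on_const open_UNIV component_smooth Y)+
  have lin: "X p (\<lambda>q. t * Y q (\<lambda>r. F r $ b) + u * Y q (\<lambda>r. N r $ b)) = t * ?P b + u * ?Q b" for b t u
    unfolding tangent_fun_add[OF Xp sm]
      tangent_fun_cmult[OF Xp smooth_everywhere[OF component_smooth(1)[OF Y]]]
      tangent_fun_cmult[OF Xp smooth_everywhere[OF component_smooth(2)[OF Y]]] ..
  have P: "push X (\<tau> p) (\<lambda>q. push Y q (\<lambda>r. F r $ b)) = c * ?P b + s * ?Q b" for b
    unfolding push_derivative[OF component_smooth(1)[OF push_field[OF Y]]] push_apply[of Y] d\<tau>_F[OF Yq]
    by (rule lin)
  have Q: "push X (\<tau> p) (\<lambda>q. push Y q (\<lambda>r. N r $ b)) = s * ?P b - c * ?Q b" for b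
    unfolding push_derivative[OF component_smooth(2)[OF push_field[OF Y]]] push_apply[of Y] d\<tau>_N[OF Yq]
    using lin[of s b "- c"] by simp
  have "cubic_form (push X) (push Y) (\<tau> p) (d\<tau> p z) =
      (\<Sum>b\<in>UNIV. (c * ?P b + s * ?Q b) * (s * z (\<lambda>q. F q $ b) - c * z (\<lambda>q. N q $ b))
        - (s * ?P b - c * ?Q b) * (c * z (\<lambda>q. F q $ b) + s * z (\<lambda>q. N q $ b)))"
    by (simp add: cubic_form_def P Q d\<tau>_F[OF z] d\<tau>_N[OF z] sum_subtractf)
  \<comment> \<open>The summand is a 2 by 2 determinant in the \<open>F\<close> and \<open>N\<close>
    parts. The cs terms cancel, and the factor left over is the determinant -(c^2 + s^2) of the
    reflection.\<close>
  also have "\<dots> = (\<Sum>b\<in>UNIV. (c * c + s * s) * (?Q b * z (\<lambda>q. F q $ b) - ?P b * z (\<lambda>q. N q $ b)))"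
    by (intro sum.cong refl) (simp add: algebra_simps)
  finally show ?thesis by (simp add: norm_1' cubic_form_def sum_subtractf)
qed

lemma ghat_reflect:
  assumes x: "x \<in> tangent_space A p" and y: "y \<in> tangent_space A p"
  shows "ghat0 (\<tau> p) (d\<tau> p x) (d\<tau> p y) = ghat0 p x y"
proof -
  have "(c * a + s * b) * (c * a' + s * b') + (s * a - c * b) * (s * a' - c * b') = a * a' + b * b'"
    for a b a' b'
  proof -
    have "(c * a + s * b) * (c * a' + s * b') + (s * a - c * b) * (s * a' - c * b') =
        (c * c + s * s) * (a * a' + b * b')"
      by (simp add: algebra_simps)
    then show ?thesis by (simp add: norm_1')
  qed
  then show ?thesis
    by (simp add: ghat_eq[OF d\<tau>_tangent[OF x] d\<tau>_tangent[OF y]] ghat_eq[OF x y]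
        d\<tau>_F[OF x] d\<tau>_N[OF x] d\<tau>_F[OF y] d\<tau>_N[OF y])
qed

text \<open>An isometric involution is its own adjoint.\<close>

lemma ghat_reflect_right:
  assumes x: "x \<in> tangent_space A (\<tau> p)" and y: "y \<in> tangent_space A p"
  shows "ghat0 (\<tau> p) x (d\<tau> p y) = ghat0 p (d\<tau> (\<tau> p) x) y"
proof -
  have t: "d\<tau> (\<tau> p) x \<in> tangent_space A p" using d\<tau>_tangent[OF x] by simp
  have "d\<tau> p (d\<tau> (\<tau> p) x) = x" using d\<tau>_involution[OF x] by simp
  then show ?thesis using ghat_reflect[OF t y] by simp
qed

text \<open>The reflection is an isometry of \<open>ghat\<close>, so it preserves the Levi-Civita connection
  by uniqueness.\<close>

lemma D_push:
  assumes X: "X \<in> vector_fields A" and Y: "Y \<in> vector_fields A"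
  shows "D (push X) (push Y) (\<tau> p) = d\<tau> p (D X Y p)"
proof -
  \<comment> \<open>\<open>D'\<close> is the connection transported by \<tau> and evaluated at p;
    the torsion and metric laws at p are enough to identify it with \<open>D\<close>.\<close>
  define D' where "D' X Y = d\<tau> (\<tau> p) (D (push X) (push Y) (\<tau> p))" for X Y
  have Dt: "D X Y q \<in> tangent_space A q" if "X \<in> vector_fields A" "Y \<in> vector_fields A" for X Y q
    by (rule vector_field_tangent[OF connection_field[OF D_connection that]])
  note Dpt = Dt[OF push_field push_field]
  have D't: "D' X Y \<in> tangent_space A p" if "X \<in> vector_fields A" "Y \<in> vector_fields A" for X Y
    using d\<tau>_tangent[OF Dpt[OF that, of "\<tau> p"]] by (simp add: D'_def)
  let ?B = "\<lambda>X Y Z. ghat0 p (D' X Y - D X Y p) (Z p)"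
  have "?B X Y Z = 0" if Z: "Z \<in> vector_fields A" for Z
  proof (rule symmetric_skew_eq_0[of "vector_fields A" ?B, OF _ _ X Y Z])
    fix X Y Z
    assume X: "X \<in> vector_fields A" and Y: "Y \<in> vector_fields A" and Z: "Z \<in> vector_fields A"
    \<comment> \<open>Naturality of the bracket under \<tau>. Globally smooth f suffice, since the
      components of \<open>F\<close> already determine a tangent vector.\<close>
    have "D' X Y f - D' Y X f = D X Y p f - D Y X p f" if f: "smooth_fun_on A UNIV f" for f
    proof -
      note f' = smooth_reflect[OF f]
      have "D' X Y f - D' Y X f = lie_bracket A (push X) (push Y) (\<tau> p) (\<lambda>q. f (\<tau> q))"
        by (simp add: D'_def d\<tau>_apply[OF f] levi_civita_torsion[OF D push_field[OF X] push_field[OF Y], symmetric])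
      also have "\<dots> = lie_bracket A X Y p f"
        using vector_field_smooth[OF push_field[OF X] open_UNIV f']
          vector_field_smooth[OF push_field[OF Y] open_UNIV f']
        by (simp add: lie_bracket_apply[OF f'] lie_bracket_apply[OF f] push_derivative f')
      also have "\<dots> = D X Y p f - D Y X p f"
        by (simp add: levi_civita_torsion[OF D X Y, symmetric])
      finally show ?thesis .
    qed
    then have "D' X Y - D X Y p = D' Y X - D Y X p"
      by (intro tangent_eqI[OF tangent_diff[OF D't Dt] tangent_diff[OF D't Dt]] X Y)
        (simp, smt (verit) F_smooth)
    then show "?B X Y Z = ?B Y X Z" by simp
    \<comment> \<open>Invariance of \<open>ghat\<close> converts the metric law at
      \<open>\<tau> p\<close> for the pushed fields into the metric law of \<open>D'\<close> at
      p.\<close>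
    have "ghat0 p (D' X Y) (Z p) + ghat0 p (Y p) (D' X Z) =
        push X (\<tau> p) (\<lambda>q. ghat0 q (push Y q) (push Z q))"
      unfolding levi_civita_metric[OF D push_field[OF X] push_field[OF Y] push_field[OF Z]]
      using ghat_reflect_right[OF Dpt[OF X Y] vector_field_tangent[OF Z]]
        ghat_reflect_right[OF Dpt[OF X Z] vector_field_tangent[OF Y]]
        ghat_commute[OF vector_field_tangent[OF push_field[OF Y]] Dpt[OF X Z], of "\<tau> p"]
        ghat_commute[OF vector_field_tangent[OF Y] D't[OF X Z]]
      by (simp add: D'_def push_apply)
    also have "\<dots> = X p (\<lambda>q. ghat0 q (Y q) (Z q))"
      unfolding push_derivative[OF ghat_smooth[OF push_field[OF Y] push_field[OF Z]]]
      by (simp add: push_apply ghat_reflect vector_field_tangent Y Z)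
    also have "\<dots> = ghat0 p (D X Y p) (Z p) + ghat0 p (Y p) (D X Z p)"
      by (rule levi_civita_metric[OF D X Y Z])
    finally show "?B X Y Z = - ?B X Z Y"
      using ghat_commute[OF vector_field_tangent[OF Y] D't[OF X Z]]
        ghat_commute[OF vector_field_tangent[OF Y] Dt[OF X Z]]
      by (simp add: ghat_diff_left D't Dt X Y Z vector_field_tangent)
  qed
  then have "ghat0 p (D' X Y) z = ghat0 p (D X Y p) z" if z: "z \<in> tangent_space A p" for z
    using vector_field_through[OF z] ghat_diff_left[OF D't[OF X Y] Dt[OF X Y] z]
    by (metis eq_iff_diff_eq_0)
  then have "D' X Y = D X Y p"
    by (intro ghat_eqI[OF D't[OF X Y] Dt[OF X Y]])
  then show ?thesis
    using d\<tau>_involution[OF Dpt[OF X Y], of "\<tau> p"] by (simp add: D'_def)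
qed

section \<open>Tensors that change sign under the reflection\<close>

definition anti_invariant :: "nat \<Rightarrow> 'm tensor \<Rightarrow> bool"
  where "anti_invariant k T \<longleftrightarrow> (\<forall>p vs. length vs = k \<longrightarrow> set vs \<subseteq> tangent_space A p \<longrightarrow>
    T (\<tau> p) (map (d\<tau> p) vs) = - T p vs)"

lemma anti_invariantD:
  "anti_invariant k T \<Longrightarrow> length vs = k \<Longrightarrow> set vs \<subseteq> tangent_space A p \<Longrightarrow>
    T (\<tau> p) (map (d\<tau> p) vs) = - T p vs"
  by (simp add: anti_invariant_def)

lemma alpha_anti_invariant: "anti_invariant 3 alpha0"
  unfolding anti_invariant_def
proof (intro allI impI)
  fix p and vs :: "'m tvec list"
  assume "length vs = 3" and vt: "set vs \<subseteq> tangent_space A p"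
  then obtain x y z where v: "vs = [x, y, z]"
    by (auto simp: numeral_3_eq_3 length_Suc_conv)
  then have x: "x \<in> tangent_space A p" and y: "y \<in> tangent_space A p" and z: "z \<in> tangent_space A p"
    using vt by auto
  obtain X where X: "X \<in> vector_fields A" "X p = x" using vector_field_through[OF x] .
  obtain Y where Y: "Y \<in> vector_fields A" "Y p = y" using vector_field_through[OF y] .
  show "alpha0 (\<tau> p) (map (d\<tau> p) vs) = - alpha0 p vs"
    using cubic_form_reflect[OF X(1) Y(1) z] alpha_eq[OF X(1) Y(1) z]
      alpha_eq[OF push_field[OF X(1)] push_field[OF Y(1)] d\<tau>_tangent[OF z]]
    by (simp add: v X(2) Y(2) push_apply)
qed

text \<open>At \<open>\<tau> p\<close> the derivative may be computed with the pushed extensions.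
  The function being differentiated then changes sign, and so does every correction term, since
  \<tau> preserves \<open>D\<close>.\<close>

lemma cov_deriv_anti_invariant:
  assumes T: "tensor_field A k T" and anti: "anti_invariant k T"
  shows "anti_invariant (Suc k) (cov_deriv A D T)"
  unfolding anti_invariant_def
proof (intro allI impI)
  fix p and vs :: "'m tvec list"
  assume "length vs = Suc k" and vt: "set vs \<subseteq> tangent_space A p"
  then obtain v ws where v: "vs = v # ws" "length ws = k" by (cases vs) auto
  then have vw: "v \<in> tangent_space A p" "set ws \<subseteq> tangent_space A p" using vt by auto
  obtain X where X: "X \<in> vector_fields A" "X p = v" using vector_field_through[OF vw(1)] .
  obtain Ys where Ys: "set Ys \<subseteq> vector_fields A" "map (\<lambda>Y. Y p) Ys = ws"
    using vector_fields_through[OF vw(2)] .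
  have len: "length Ys = k" using Ys(2) v(2) by (metis length_map)
  let ?Zs = "map push Ys"
  have Zs: "set ?Zs \<subseteq> vector_fields A" "length ?Zs = k" using Ys(1) len push_field by auto
  have mapZ: "map (\<lambda>Y. Y (\<tau> q)) ?Zs = map (d\<tau> q) (map (\<lambda>Y. Y q) Ys)" for q
    by (simp add: push_apply)
  have TZ: "T (\<tau> q) (map (\<lambda>Y. Y (\<tau> q)) ?Zs) = - T q (map (\<lambda>Y. Y q) Ys)" for q
    unfolding mapZ by (rule anti_invariantD[OF anti _ map_vector_fields_tangent[OF Ys(1)]]) (simp add: len)
  have "push X (\<tau> p) (\<lambda>q. T q (map (\<lambda>Y. Y q) ?Zs)) = X p (\<lambda>q. - T q (map (\<lambda>Y. Y q) Ys))"
    unfolding push_derivative[OF tensor_field_smooth[OF T Zs(2,1)]] TZ ..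
  also have "\<dots> = - X p (\<lambda>q. T q (map (\<lambda>Y. Y q) Ys))"
    by (rule tangent_fun_uminus[OF vector_field_tangent[OF X(1)]
          smooth_everywhere[OF tensor_field_smooth[OF T len Ys(1)]]])
  finally have 1: "push X (\<tau> p) (\<lambda>q. T q (map (\<lambda>Y. Y q) ?Zs)) = - X p (\<lambda>q. T q (map (\<lambda>Y. Y q) Ys))" .
  \<comment> \<open>By \<open>D_push\<close>, inserting the derivative of the pushed field is the
    same as reflecting the whole updated list, to which the sign rule for T applies.\<close>
  have 2: "T (\<tau> p) ((map (\<lambda>Y. Y (\<tau> p)) ?Zs)[i := D (push X) (?Zs ! i) (\<tau> p)]) =
      - T p ((map (\<lambda>Y. Y p) Ys)[i := D X (Ys ! i) p])" if i: "i < k" for i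
  proof -
    have Yi: "Ys ! i \<in> vector_fields A" using i len Ys(1) nth_mem by blast
    have "D (push X) (?Zs ! i) (\<tau> p) = d\<tau> p (D X (Ys ! i) p)"
      using D_push[OF X(1) Yi] i len by simp
    then have "(map (\<lambda>Y. Y (\<tau> p)) ?Zs)[i := D (push X) (?Zs ! i) (\<tau> p)] =
        map (d\<tau> p) ((map (\<lambda>Y. Y p) Ys)[i := D X (Ys ! i) p])"
      unfolding mapZ by (simp only: map_update)
    moreover have "set ((map (\<lambda>Y. Y p) Ys)[i := D X (Ys ! i) p]) \<subseteq> tangent_space A p"
      by (intro set_update_subset map_vector_fields_tangent Ys(1)
          vector_field_tangent[OF connection_field[OF D_connection X(1) Yi]])
    ultimately show ?thesis
      using anti_invariantD[OF anti] len by simp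
  qed
  have "cov_diff D T (push X) ?Zs (\<tau> p) = - cov_diff D T X Ys p"
  proof -
    have "(\<Sum>i<k. T (\<tau> p) ((map (\<lambda>Y. Y (\<tau> p)) ?Zs)[i := D (push X) (?Zs ! i) (\<tau> p)])) =
        (\<Sum>i<k. - T p ((map (\<lambda>Y. Y p) Ys)[i := D X (Ys ! i) p]))"
      by (rule sum.cong) (simp_all only: 2 lessThan_iff)
    then show ?thesis unfolding cov_diff_def Zs(2) len 1 by (simp add: sum_negf)
  qed
  then show "cov_deriv A D T (\<tau> p) (map (d\<tau> p) vs) = - cov_deriv A D T p vs"
    using cov_deriv_eq[OF D_connection T Zs push_field[OF X(1)], of "\<tau> p"]
      cov_deriv_eq[OF D_connection T Ys(1) len X(1), of p]
    unfolding mapZ by (simp add: v(1) Ys(2) X(2) push_apply)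
qed

text \<open>The two properties are carried together because the sign rule passes to \<nabla>T only
  for genuine tensor fields. The rank is i + 3: each derivative adds one argument to the three of
  \<alpha>.\<close>

lemma cov_deriv_power_alpha:
  "tensor_field A (i + 3) ((cov_deriv A D ^^ i) alpha0) \<and>
    anti_invariant (i + 3) ((cov_deriv A D ^^ i) alpha0)"
proof (induction i)
  case 0
  then show ?case using alpha_tensor_field alpha_anti_invariant by simp
next
  case (Suc i)
  then show ?case
    using cov_deriv_tensor_field[OF D_connection] cov_deriv_anti_invariant
    by (simp only: add_Suc funpow.simps(2) o_apply)
qed

end

theorem theorem3p12:
  fixes A :: "('m::{t2_space, second_countable_topology}, 'n::finite) atlas"
    and F0 nu0 :: "'m \<Rightarrow> real ^ 'k::finite"
    and g :: nat
    and lam theta :: "nat \<Rightarrow> real"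
    and D0 D :: "'m vfield \<Rightarrow> 'm vfield \<Rightarrow> 'm vfield"
    and tau :: "nat \<Rightarrow> 'm \<Rightarrow> 'm"
  assumes "smooth_atlas A"
    and "connected (UNIV :: 'm set)"
    and "compact (UNIV :: 'm set)"
    and "isoparametric A F0 nu0"
    and "\<And>p. principal_curvatures A F0 nu0 p = lam ` {1..g}"
    and "\<And>i j. \<lbrakk>i \<in> {1..g}; j \<in> {1..g}; i < j\<rbrakk> \<Longrightarrow> lam j < lam i"
    and "\<And>j. j \<in> {1..g} \<Longrightarrow> lam j = cot (theta j)"
    and "\<And>j. j \<in> {1..g} \<Longrightarrow>
           \<exists>m::int. theta j = (2 * real j - 1) * (pi / (2 * real g)) + of_int m * pi"
    and "levi_civita A (induced_metric F0) D0"
    and "levi_civita A (ghat A F0 nu0) D"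
    and "\<And>k. k \<in> {1..g} \<Longrightarrow> diffeomorphism A (tau k)"
    and "\<And>k t p. k \<in> {1..g} \<Longrightarrow>
           parallel F0 nu0 t (tau k p) = parallel F0 nu0 (2 * theta k - t) p"
    and "\<And>k t p. k \<in> {1..g} \<Longrightarrow>
           parallel_normal F0 nu0 t (tau k p) = - parallel_normal F0 nu0 (2 * theta k - t) p"
  shows "\<forall>j\<in>{1..g}.
    (\<forall>p. \<forall>X\<in>tangent_space A p. \<forall>Y\<in>tangent_space A p. \<forall>Z\<in>tangent_space A p.
       alpha A F0 nu0 D0 p [X, Y, Z] =
         - alpha A F0 nu0 D0 (tau j p)
             [differential A (tau j) p X, differential A (tau j) p Y, differential A (tau j) p Z]) \<and>
    (\<forall>i p vs. length vs = i + 3 \<longrightarrow> set vs \<subseteq> tangent_space A p \<longrightarrow>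
       (cov_deriv A D ^^ i) (alpha A F0 nu0 D0) p vs =
         - push_forward A (tau j) ((cov_deriv A D ^^ i) (alpha A F0 nu0 D0)) p vs)"
proof
  fix j assume j: "j \<in> {1..g}"
  interpret sphere_reflection A F0 nu0 D0 D "tau j" "cos (2 * theta j)" "sin (2 * theta j)"
  proof
    show "CARD('k) = CARD('n) + 2" "sphere_embedding A F0" "unit_normal_field A F0 nu0"
      using assms(4) by (simp_all add: isoparametric_def)
    show "smooth_self_map A (tau j)" using assms(11)[OF j] by (simp add: diffeomorphism_def)
    show "F0 (tau j p) = cos (2 * theta j) *\<^sub>R F0 p + sin (2 * theta j) *\<^sub>R nu0 p" for p
      using assms(12)[OF j, of 0 p] by (simp add: parallel_def)
    show "nu0 (tau j p) = sin (2 * theta j) *\<^sub>R F0 p - cos (2 * theta j) *\<^sub>R nu0 p" for p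
      using assms(13)[OF j, of 0 p] by (simp add: parallel_normal_def)
  qed (use assms in simp_all)
  have anti: "(cov_deriv A D ^^ i) alpha0 p vs =
      - (cov_deriv A D ^^ i) alpha0 (tau j p) (map (d\<tau> p) vs)"
    if "length vs = i + 3" "set vs \<subseteq> tangent_space A p" for i p vs
    using anti_invariantD[OF conjunct2[OF cov_deriv_power_alpha] that] by simp
  show "(\<forall>p. \<forall>X\<in>tangent_space A p. \<forall>Y\<in>tangent_space A p. \<forall>Z\<in>tangent_space A p.
       alpha A F0 nu0 D0 p [X, Y, Z] =
         - alpha A F0 nu0 D0 (tau j p)
             [differential A (tau j) p X, differential A (tau j) p Y, differential A (tau j) p Z]) \<and>
    (\<forall>i p vs. length vs = i + 3 \<longrightarrow> set vs \<subseteq> tangent_space A p \<longrightarrow>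
       (cov_deriv A D ^^ i) (alpha A F0 nu0 D0) p vs =
         - push_forward A (tau j) ((cov_deriv A D ^^ i) (alpha A F0 nu0 D0)) p vs)"
    \<comment> \<open>The pointwise claim is the case i = 0 with a list of three vectors; in the
      push-forward the inverse is replaced by \<tau>.\<close>
    using anti[of _ 0] anti by (simp add: push_forward_def inv_reflection)
qed

end
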